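(* Let $d\ge1$. If $G\subseteq\mathbb{T}_{\pm}^d$ is a TC-hemispace, then $G=\mathrm{sval}(\mathbf{G})$ for some convex set $\mathbf{G}\subseteq\mathbb{K}^d$.
   Context: Signed tropical numbers. Let $\mathbb{O}=-\infty$ be the tropical zero. $\mathbb{T}_{>\mathbb{O}}=\mathbb{R}$ (positive numbers), $\mathbb{T}_{<\mathbb{O}}=\{\ominus r: r\in\mathbb{R}\}$ (negative numbers), $\mathbb{T}_{\pm}=\mathbb{T}_{>\mathbb{O}}\cup\mathbb{T}_{<\mathbb{O}}\cup\{\mathbb{O}\}$, balanced numbers $\mathbb{T}_{\bullet}=\{\bullet r: r\in\mathbb{R}\}\cup\{\mathbb{O}\}$, symmetrized semiring $\mathbb{S}=\mathbb{T}_{\pm}\cup\mathbb{T}_{\bullet}$. The norm is $|r|=|\ominus r|=|\bullet r|=r$ and $|\mathbb{O}|=\mathbb{O}$; the sign $\mathrm{tsgn}$ takes values in $\{\oplus,\ominus,\bullet,\mathbb{O}\}$. Addition on $\mathbb{S}$: $x\oplus y$ equals $x$ if $|x|>|y|$, $y$ if $|y|>|x|$, $x$ if $|x|=|y|$ and $\mathrm{tsgn}(x)=\mathrm{tsgn}(y)$, and $\bullet|x|$ if $|x|=|y|$ and the signs differ. Multiplication: $x\odot y$ has norm $|x|+|y|$ and sign the product of signs (with $\oplus,\ominus,\bullet$ multiplying like $1,-1,0$); $\mathbb{O}$ is absorbing. The multiplicative unit is the real number $0$. TC-convexity. For $a=(a_0,\dots,a_d)\in\mathbb{T}_{\pm}^{d+1}$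 with $(a_1,\dots,a_d)\ne(\mathbb{O},\dots,\mathbb{O})$, the closed halfspace is $\overline{\mathcal{H}}^+(a)=\{x\in\mathbb{T}_{\pm}^d: a_0\oplus a_1\odot x_1\oplus\dots\oplus a_d\odot x_d\in\mathbb{T}_{>\mathbb{O}}\cup\mathbb{T}_{\bullet}\}$. For two points $x,y\in\mathbb{T}_{\pm}^d$, $\mathrm{conv}_{TC}(x,y)$ is the intersection of all closed halfspaces containing both. A set $S$ is TC-convex if $\mathrm{conv}_{TC}(x,y)\subseteq S$ for all $x,y\in S$. A TC-hemispace is a TC-convex set whose complement in $\mathbb{T}_{\pm}^d$ is also TC-convex. Puiseux series. $\mathbb{K}$ is the field of generalized real Puiseux series: formal series $\gamma=\sum_i c_it^{\alpha_i}$ with $\alpha_i\in\mathbb{R}$, nonzero $c_i\in\mathbb{R}$, $\alpha_0>\alpha_1>\cdots$, where $(\alpha_i)$ is finite (possibly empty, giving $0$) or unbounded. $\gamma\neq0$ is positive iff $c_0>0$; this makes $\mathbb{K}$ an ordered (real closed) field, and convexity in $\mathbb{K}^d$ is with respect to this ordered field. The signed valuation $\mathrm{sval}:\mathbb{K}\to\mathbb{T}_{\pm}$ sends $\gamma$ to $\alpha_0$ if $\gamma>0$, to $\mathbb{O}$ if $\gamma=0$, to $\ominus\alpha_0$ if $\gamma<0$; it is extended componentwise to vectors and to sets by taking images. *)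

theory Defs
  imports "HOL-Analysis.Analysis"
begin

section \<open>The symmetrized tropical semiring\<close>

datatype symtrop = TZero | TPos real | TNeg real | TBal real

datatype tsign = SZero | SPos | SNeg | SBal

primrec tnorm :: "symtrop \<Rightarrow> ereal" where
  "tnorm TZero = -\<infinity>"
| "tnorm (TPos r) = ereal r"
| "tnorm (TNeg r) = ereal r"
| "tnorm (TBal r) = ereal r"

primrec tsgn :: "symtrop \<Rightarrow> tsign" where
  "tsgn TZero = SZero"
| "tsgn (TPos r) = SPos"
| "tsgn (TNeg r) = SNeg"
| "tsgn (TBal r) = SBal"

text \<open>
  The class operations \<open>+\<close>, \<open>*\<close>, \<open>0\<close>, \<open>1\<close> on \<^typ>\<open>symtrop\<close> are the tropical \<open>\<oplus>\<close>, \<open>\<odot>\<close>,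
  the tropical zero (minus infinity) and the tropical unit (the real number 0). In the last
  branch of the addition the common norm is a real number, because \<^const>\<open>TZero\<close> is the only
  element of norm minus infinity.
\<close>

instantiation symtrop :: comm_semiring_1
begin

definition zero_symtrop :: symtrop where "0 = TZero"

definition one_symtrop :: symtrop where "1 = TPos 0"

definition plus_symtrop :: "symtrop \<Rightarrow> symtrop \<Rightarrow> symtrop" where
  "x + y =
    (if tnorm x > tnorm y then x
     else if tnorm y > tnorm x then y
     else if tsgn x = tsgn y then x
     else TBal (real_of_ereal (tnorm x)))"

fun times_symtrop :: "symtrop \<Rightarrow> symtrop \<Rightarrow> symtrop" where
  "TZero * y = TZero"
| "x * TZero = TZero"
| "TPos r * TPos s = TPos (r + s)"
| "TPos r * TNeg s = TNeg (r + s)"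
| "TPos r * TBal s = TBal (r + s)"
| "TNeg r * TPos s = TNeg (r + s)"
| "TNeg r * TNeg s = TPos (r + s)"
| "TNeg r * TBal s = TBal (r + s)"
| "TBal r * TPos s = TBal (r + s)"
| "TBal r * TNeg s = TBal (r + s)"
| "TBal r * TBal s = TBal (r + s)"

instance
proof
  fix x y z :: symtrop
  show "x + y + z = x + (y + z)"
    by (cases x; cases y; cases z) (auto simp: plus_symtrop_def)
  show "x + y = y + x"
    by (cases x; cases y) (auto simp: plus_symtrop_def)
  show "0 + x = x"
    by (cases x) (auto simp: plus_symtrop_def zero_symtrop_def)
  show "x * y * z = x * (y * z)"
    by (cases x; cases y; cases z) auto
  show "x * y = y * x"
    by (cases x; cases y) auto
  show "1 * x = x"
    by (cases x) (auto simp: one_symtrop_def)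
  show "(x + y) * z = x * z + y * z"
    by (cases x; cases y; cases z) (auto simp: plus_symtrop_def)
  show "0 * x = 0" "x * 0 = 0"
    by (cases x; simp add: zero_symtrop_def)+
  show "(0::symtrop) \<noteq> 1"
    by (simp add: zero_symtrop_def one_symtrop_def)
qed

end

definition tpositive :: "symtrop set" where
  "tpositive = range TPos"

definition tnegative :: "symtrop set" where
  "tnegative = range TNeg"

definition tbalanced :: "symtrop set" where
  "tbalanced = range TBal \<union> {TZero}"

definition tsigned :: "symtrop set" where
  "tsigned = tpositive \<union> tnegative \<union> {TZero}"

section \<open>TC-convexity\<close>

definition signed_space :: "(symtrop ^ 'n::finite) set" where
  "signed_space = {x. \<forall>i. x $ i \<in> tsigned}"

definition closed_halfspace :: "symtrop \<Rightarrow> symtrop ^ 'n::finite \<Rightarrow> (symtrop ^ 'n) set" where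
  "closed_halfspace a0 a =
    {x \<in> signed_space. a0 + (\<Sum>i\<in>UNIV. a $ i * x $ i) \<in> tpositive \<union> tbalanced}"

definition closed_halfspaces :: "(symtrop ^ 'n::finite) set set" where
  "closed_halfspaces =
    {closed_halfspace a0 a | a0 a. a0 \<in> tsigned \<and> a \<in> signed_space \<and> (\<exists>i. a $ i \<noteq> 0)}"

definition conv_TC :: "symtrop ^ 'n::finite \<Rightarrow> symtrop ^ 'n \<Rightarrow> (symtrop ^ 'n) set" where
  "conv_TC x y = \<Inter>{H \<in> closed_halfspaces. x \<in> H \<and> y \<in> H}"

definition TC_convex :: "(symtrop ^ 'n::finite) set \<Rightarrow> bool" where
  "TC_convex S \<longleftrightarrow> S \<subseteq> signed_space \<and> (\<forall>x\<in>S. \<forall>y\<in>S. conv_TC x y \<subseteq> S)"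

definition TC_hemispace :: "(symtrop ^ 'n::finite) set \<Rightarrow> bool" where
  "TC_hemispace S \<longleftrightarrow> TC_convex S \<and> TC_convex (signed_space - S)"

section \<open>Generalized real Puiseux series\<close>

definition puiseux_exponents :: "real set \<Rightarrow> bool" where
  "puiseux_exponents A \<longleftrightarrow>
    finite A \<or> (\<exists>a :: nat \<Rightarrow> real. strict_antimono_on UNIV a \<and> \<not> bdd_below (range a) \<and> A = range a)"

lemma puiseux_exponents_iff: "puiseux_exponents A \<longleftrightarrow> (\<forall>b. finite (A \<inter> {b..}))"
proof
  assume "puiseux_exponents A"
  then consider "finite A"
    | a :: "nat \<Rightarrow> real" where "strict_antimono_on UNIV a" "\<not> bdd_below (range a)" "A = range a"
    unfolding puiseux_exponents_def by auto
  then show "\<forall>b. finite (A \<inter> {b..})"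
  proof cases
    case 1
    then show ?thesis by simp
  next
    case 2
    show ?thesis
    proof
      fix b
      obtain i where i: "a i < b"
        using 2(2) by (force simp: bdd_below_def not_le)
      have "A \<inter> {b..} \<subseteq> a ` {..i}"
      proof
        fix x assume "x \<in> A \<inter> {b..}"
        then obtain j where j: "x = a j" "b \<le> a j" using 2(3) by auto
        have "j \<le> i"
        proof (rule ccontr)
          assume "\<not> j \<le> i"
          then have "a j < a i" using 2(1) by (simp add: monotone_on_def)
          with i j show False by linarith
        qed
        with j show "x \<in> a ` {..i}" by auto
      qed
      then show "finite (A \<inter> {b..})" by (rule finite_subset) simp
    qed
  qed
next
  assume fin: "\<forall>b. finite (A \<inter> {b..})"
  show "puiseux_exponents A"
  proof (cases "finite A")
    case True
    then show ?thesis by (simp add: puiseux_exponents_def)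
  next
    case False
    have ex: "\<exists>y\<in>B. \<forall>z\<in>B. z \<le> y" if B: "B \<subseteq> A" "B \<noteq> {}" for B
    proof -
      obtain y0 where y0: "y0 \<in> B" using B by auto
      have f: "finite (B \<inter> {y0..})"
        by (rule finite_subset[OF _ fin[rule_format, of y0]]) (use B in auto)
      have "Max (B \<inter> {y0..}) \<in> B \<inter> {y0..}" using f y0 by (intro Max_in) auto
      moreover have "z \<le> Max (B \<inter> {y0..})" if "z \<in> B" for z
      proof (cases "y0 \<le> z")
        case True
        then show ?thesis using f that by (intro Max_ge) auto
      next
        case False
        then show ?thesis using calculation by auto
      qed
      ultimately show ?thesis by auto
    qed
    have ne: "A \<inter> {..<x} \<noteq> {}" for x
    proof
      assume "A \<inter> {..<x} = {}"
      then have "A = A \<inter> {x..}" by force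
      with fin False show False by metis
    qed
    obtain m where m: "m \<in> A" "\<forall>z\<in>A. z \<le> m"
      using ex[of A] False by (metis finite.emptyI subset_refl)
    have "\<exists>y. y \<in> A \<and> y < x \<and> (\<forall>z\<in>A. z < x \<longrightarrow> z \<le> y)" for x
      using ex[of "A \<inter> {..<x}"] ne[of x] by auto
    then obtain nx where nx: "\<And>x. nx x \<in> A" "\<And>x. nx x < x" "\<And>x z. z \<in> A \<Longrightarrow> z < x \<Longrightarrow> z \<le> nx x"
      by metis
    define a where "a = rec_nat m (\<lambda>_. nx)"
    have a0: "a 0 = m" and aS: "a (Suc n) = nx (a n)" for n by (simp_all add: a_def)
    have aA: "a n \<in> A" for n by (cases n) (simp_all add: a0 aS m nx)
    have dec: "a j < a i" if "i < j" for i j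
      using that by (induction j) (auto simp: less_Suc_eq aS nx(2) intro: less_trans[OF nx(2)])
    have inj: "inj a" by (rule injI) (metis dec less_irrefl nat_neq_iff)
    have unb: "\<exists>i. a i < b" for b
    proof (rule ccontr)
      assume "\<nexists>i. a i < b"
      then have "range a \<subseteq> A \<inter> {b..}" using aA by (auto simp: not_less)
      then have "finite (range a)" using fin finite_subset by blast
      with inj show False using finite_imageD infinite_UNIV_nat by blast
    qed
    have "z \<in> range a" if "z \<in> A" for z
    proof -
      define i where "i = (LEAST i. a i \<le> z)"
      have i: "a i \<le> z" unfolding i_def using unb[of z] by (metis LeastI less_imp_le)
      have "z \<le> a i"
      proof (cases i)
        case 0
        then show ?thesis using m that a0 by simp
      next
        case (Suc k)
        then have "\<not> a k \<le> z" using not_less_Least[of k "\<lambda>i. a i \<le> z"] i_def by simp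
        then show ?thesis using nx(3)[OF that, of "a k"] Suc aS by simp
      qed
      with i show ?thesis by (metis antisym rangeI)
    qed
    then have "A = range a" using aA by auto
    moreover have "strict_antimono_on UNIV a" using dec by (simp add: monotone_on_def)
    moreover have "\<not> bdd_below (range a)"
      using unb unfolding bdd_below_def by (metis not_less rangeI)
    ultimately show ?thesis unfolding puiseux_exponents_def by (intro disjI2 exI[of _ a] conjI)
  qed
qed

text \<open>A series is represented by its coefficient function, indexed by the exponents of \<open>t\<close>.\<close>

typedef puiseux = "{c :: real \<Rightarrow> real. puiseux_exponents {\<alpha>. c \<alpha> \<noteq> 0}}"
  morphisms pcoeff Abs_puiseux
  by (rule exI[of _ "\<lambda>_. 0"]) (simp add: puiseux_exponents_def)

setup_lifting type_definition_puiseux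

lemma pcoeff_eqI: "(\<And>\<alpha>. pcoeff f \<alpha> = pcoeff g \<alpha>) \<Longrightarrow> f = g"
  by (simp add: pcoeff_inject[symmetric] fun_eq_iff)

lemma puiseux_exponents_finite: "puiseux_exponents A \<Longrightarrow> finite (A \<inter> {b..})"
  by (simp add: puiseux_exponents_iff)

lemma puiseux_exponents_subset: "puiseux_exponents A \<Longrightarrow> B \<subseteq> A \<Longrightarrow> puiseux_exponents B"
  unfolding puiseux_exponents_iff by (meson Int_mono finite_subset order_refl)

lemma puiseux_exponents_Un: "puiseux_exponents A \<Longrightarrow> puiseux_exponents B \<Longrightarrow> puiseux_exponents (A \<union> B)"
  by (simp add: puiseux_exponents_iff Int_Un_distrib2)

lemma puiseux_exponents_bound:
  assumes "puiseux_exponents A"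
  obtains M where "\<And>x. x \<in> A \<Longrightarrow> x \<le> M"
proof
  fix x assume x: "x \<in> A"
  have f: "finite (A \<inter> {0..})" using assms by (rule puiseux_exponents_finite)
  show "x \<le> Max (insert 0 (A \<inter> {0..}))"
    by (cases "0 \<le> x") (use f x in \<open>auto intro: Max_ge order_trans[of x 0]\<close>)
qed

instantiation puiseux :: "{zero, one, plus, minus, uminus, times}"
begin

lift_definition zero_puiseux :: puiseux is "\<lambda>_. 0"
  by (simp add: puiseux_exponents_def)

lift_definition one_puiseux :: puiseux is "\<lambda>\<alpha>. if \<alpha> = 0 then 1 else 0"
  by (simp add: puiseux_exponents_def)

lift_definition plus_puiseux :: "puiseux \<Rightarrow> puiseux \<Rightarrow> puiseux" is "\<lambda>f g \<alpha>. f \<alpha> + g \<alpha>"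
  by (rule puiseux_exponents_subset, erule (1) puiseux_exponents_Un) auto

lift_definition minus_puiseux :: "puiseux \<Rightarrow> puiseux \<Rightarrow> puiseux" is "\<lambda>f g \<alpha>. f \<alpha> - g \<alpha>"
  by (rule puiseux_exponents_subset, erule (1) puiseux_exponents_Un) auto

lift_definition uminus_puiseux :: "puiseux \<Rightarrow> puiseux" is "\<lambda>f \<alpha>. - f \<alpha>"
  by simp

lift_definition times_puiseux :: "puiseux \<Rightarrow> puiseux \<Rightarrow> puiseux" is
  "\<lambda>f g \<alpha>. \<Sum>\<beta> | f \<beta> \<noteq> 0 \<and> g (\<alpha> - \<beta>) \<noteq> 0. f \<beta> * g (\<alpha> - \<beta>)"
proof -
  fix f g :: "real \<Rightarrow> real"
  assume f: "puiseux_exponents {\<alpha>. f \<alpha> \<noteq> 0}" and g: "puiseux_exponents {\<alpha>. g \<alpha> \<noteq> 0}"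
  obtain M where M: "\<And>x. f x \<noteq> 0 \<Longrightarrow> x \<le> M" using puiseux_exponents_bound[OF f] by auto
  obtain N where N: "\<And>x. g x \<noteq> 0 \<Longrightarrow> x \<le> N" using puiseux_exponents_bound[OF g] by auto
  let ?h = "\<lambda>\<alpha>. \<Sum>\<beta> | f \<beta> \<noteq> 0 \<and> g (\<alpha> - \<beta>) \<noteq> 0. f \<beta> * g (\<alpha> - \<beta>)"
  show "puiseux_exponents {\<alpha>. ?h \<alpha> \<noteq> 0}"
    unfolding puiseux_exponents_iff
  proof
    fix b
    let ?A = "{\<alpha>. f \<alpha> \<noteq> 0} \<inter> {b - N..}" and ?B = "{\<alpha>. g \<alpha> \<noteq> 0} \<inter> {b - M..}"
    have "{\<alpha>. ?h \<alpha> \<noteq> 0} \<inter> {b..} \<subseteq> (\<lambda>(\<beta>, \<gamma>). \<beta> + \<gamma>) ` (?A \<times> ?B)"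
    proof
      fix \<alpha> assume a: "\<alpha> \<in> {\<alpha>. ?h \<alpha> \<noteq> 0} \<inter> {b..}"
      then obtain \<beta> where b: "f \<beta> \<noteq> 0" "g (\<alpha> - \<beta>) \<noteq> 0"
        by (auto elim: sum.not_neutral_contains_not_neutral)
      have "(\<beta>, \<alpha> - \<beta>) \<in> ?A \<times> ?B" using a b M[of \<beta>] N[of "\<alpha> - \<beta>"] by auto
      then show "\<alpha> \<in> (\<lambda>(\<beta>, \<gamma>). \<beta> + \<gamma>) ` (?A \<times> ?B)" by (intro rev_image_eqI) auto
    qed
    moreover have "finite (?A \<times> ?B)" using f g by (intro finite_cartesian_product puiseux_exponents_finite)
    ultimately show "finite ({\<alpha>. ?h \<alpha> \<noteq> 0} \<inter> {b..})" by (meson finite_imageI finite_subset)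
  qed
qed

instance ..

end

lemma pcoeff_simps [simp]:
  "pcoeff 0 \<alpha> = 0"
  "pcoeff (f + g) \<alpha> = pcoeff f \<alpha> + pcoeff g \<alpha>"
  "pcoeff (f - g) \<alpha> = pcoeff f \<alpha> - pcoeff g \<alpha>"
  "pcoeff (- f) \<alpha> = - pcoeff f \<alpha>"
  by (transfer; simp)+

lemma pcoeff_one: "pcoeff 1 \<alpha> = (if \<alpha> = 0 then 1 else 0)"
  by transfer simp

lemma pcoeff_exponents: "puiseux_exponents {\<alpha>. pcoeff f \<alpha> \<noteq> 0}"
  using pcoeff[of f] by simp

lemma pcoeff_bound:
  obtains M where "\<And>x. pcoeff f x \<noteq> 0 \<Longrightarrow> x \<le> M"
  using puiseux_exponents_bound[OF pcoeff_exponents[of f]] by auto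

lemma finite_times_index: "finite {\<beta>. pcoeff f \<beta> \<noteq> 0 \<and> pcoeff g (\<alpha> - \<beta>) \<noteq> 0}"
proof -
  obtain N where N: "\<And>x. pcoeff g x \<noteq> 0 \<Longrightarrow> x \<le> N" using pcoeff_bound by auto
  show ?thesis
    by (rule finite_subset[OF _ puiseux_exponents_finite[OF pcoeff_exponents[of f], of "\<alpha> - N"]])
      (use N in force)
qed

lemma pcoeff_times:
  assumes "finite A" "\<And>\<beta>. pcoeff f \<beta> \<noteq> 0 \<Longrightarrow> pcoeff g (\<alpha> - \<beta>) \<noteq> 0 \<Longrightarrow> \<beta> \<in> A"
  shows "pcoeff (f * g) \<alpha> = (\<Sum>\<beta>\<in>A. pcoeff f \<beta> * pcoeff g (\<alpha> - \<beta>))"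
proof -
  have "pcoeff (f * g) \<alpha> =
      (\<Sum>\<beta> | pcoeff f \<beta> \<noteq> 0 \<and> pcoeff g (\<alpha> - \<beta>) \<noteq> 0. pcoeff f \<beta> * pcoeff g (\<alpha> - \<beta>))"
    by transfer simp
  also have "\<dots> = (\<Sum>\<beta>\<in>A. pcoeff f \<beta> * pcoeff g (\<alpha> - \<beta>))"
    by (rule sum.mono_neutral_left) (use assms in auto)
  finally show ?thesis .
qed

lemma pcoeff_times_pairs:
  "pcoeff (f * g) \<alpha> =
    (\<Sum>(\<beta>, \<gamma>) | pcoeff f \<beta> \<noteq> 0 \<and> pcoeff g \<gamma> \<noteq> 0 \<and> \<beta> + \<gamma> = \<alpha>. pcoeff f \<beta> * pcoeff g \<gamma>)"
proof -
  have "pcoeff (f * g) \<alpha> =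
      (\<Sum>\<beta> | pcoeff f \<beta> \<noteq> 0 \<and> pcoeff g (\<alpha> - \<beta>) \<noteq> 0. pcoeff f \<beta> * pcoeff g (\<alpha> - \<beta>))"
    by (rule pcoeff_times[OF finite_times_index]) simp
  also have "\<dots> =
      (\<Sum>(\<beta>, \<gamma>) | pcoeff f \<beta> \<noteq> 0 \<and> pcoeff g \<gamma> \<noteq> 0 \<and> \<beta> + \<gamma> = \<alpha>. pcoeff f \<beta> * pcoeff g \<gamma>)"
    by (rule sum.reindex_bij_witness[of _ fst "\<lambda>\<beta>. (\<beta>, \<alpha> - \<beta>)"]) auto
  finally show ?thesis .
qed

lemma pcoeff_times_triples:
  "pcoeff (f * g * h) \<alpha> =
    (\<Sum>(\<beta>, \<gamma>, \<delta>) | pcoeff f \<beta> \<noteq> 0 \<and> pcoeff g \<gamma> \<noteq> 0 \<and> pcoeff h \<delta> \<noteq> 0 \<and> \<beta> + \<gamma> + \<delta> = \<alpha>.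
      pcoeff f \<beta> * pcoeff g \<gamma> * pcoeff h \<delta>)"
proof -
  define T where "T = {(\<beta>, \<gamma>, \<delta>). pcoeff f \<beta> \<noteq> 0 \<and> pcoeff g \<gamma> \<noteq> 0 \<and> pcoeff h \<delta> \<noteq> 0 \<and> \<beta> + \<gamma> + \<delta> = \<alpha>}"
  define P where "P = (\<lambda>f g \<alpha>. {(\<beta>, \<gamma>). pcoeff f \<beta> \<noteq> 0 \<and> pcoeff g \<gamma> \<noteq> 0 \<and> \<beta> + \<gamma> = \<alpha>})"
  define k :: "real \<times> real \<times> real \<Rightarrow> real \<times> real" where "k = (\<lambda>(\<beta>, \<gamma>, \<delta>). (\<beta> + \<gamma>, \<delta>))"
  define F where "F = (\<lambda>(\<beta>, \<gamma>, \<delta>). pcoeff f \<beta> * pcoeff g \<gamma> * pcoeff h \<delta>)"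
  obtain Mf where Mf: "\<And>x. pcoeff f x \<noteq> 0 \<Longrightarrow> x \<le> Mf" using pcoeff_bound[of f] by auto
  obtain Mg where Mg: "\<And>x. pcoeff g x \<noteq> 0 \<Longrightarrow> x \<le> Mg" using pcoeff_bound[of g] by auto
  obtain Mh where Mh: "\<And>x. pcoeff h x \<noteq> 0 \<Longrightarrow> x \<le> Mh" using pcoeff_bound[of h] by auto
  have finT: "finite T"
  proof (rule finite_subset)
    show "T \<subseteq> ({x. pcoeff f x \<noteq> 0} \<inter> {\<alpha> - Mg - Mh..}) \<times> ({x. pcoeff g x \<noteq> 0} \<inter> {\<alpha> - Mf - Mh..})
        \<times> ({x. pcoeff h x \<noteq> 0} \<inter> {\<alpha> - Mf - Mg..})"
    proof
      fix t assume "t \<in> T"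
      then obtain \<beta> \<gamma> \<delta> where t: "t = (\<beta>, \<gamma>, \<delta>)"
        "pcoeff f \<beta> \<noteq> 0" "pcoeff g \<gamma> \<noteq> 0" "pcoeff h \<delta> \<noteq> 0" "\<beta> + \<gamma> + \<delta> = \<alpha>"
        by (auto simp: T_def)
      then have "\<beta> \<le> Mf" "\<gamma> \<le> Mg" "\<delta> \<le> Mh" by (simp_all add: Mf Mg Mh)
      with t show "t \<in> ({x. pcoeff f x \<noteq> 0} \<inter> {\<alpha> - Mg - Mh..}) \<times>
          ({x. pcoeff g x \<noteq> 0} \<inter> {\<alpha> - Mf - Mh..}) \<times> ({x. pcoeff h x \<noteq> 0} \<inter> {\<alpha> - Mf - Mg..})"
        by auto
    qed
    show "finite (({x. pcoeff f x \<noteq> 0} \<inter> {\<alpha> - Mg - Mh..}) \<times> ({x. pcoeff g x \<noteq> 0} \<inter> {\<alpha> - Mf - Mh..})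
        \<times> ({x. pcoeff h x \<noteq> 0} \<inter> {\<alpha> - Mf - Mg..}))"
      by (intro finite_cartesian_product puiseux_exponents_finite pcoeff_exponents)
  qed
  have sub: "P (f * g) h \<alpha> \<subseteq> k ` T"
  proof
    fix p assume "p \<in> P (f * g) h \<alpha>"
    then obtain x \<delta> where p: "p = (x, \<delta>)" "pcoeff (f * g) x \<noteq> 0" "pcoeff h \<delta> \<noteq> 0" "x + \<delta> = \<alpha>"
      by (auto simp: P_def)
    then obtain \<beta> \<gamma> where "pcoeff f \<beta> \<noteq> 0" "pcoeff g \<gamma> \<noteq> 0" "\<beta> + \<gamma> = x"
      unfolding pcoeff_times_pairs by (auto elim: sum.not_neutral_contains_not_neutral)
    with p show "p \<in> k ` T" by (intro image_eqI[of _ _ "(\<beta>, \<gamma>, \<delta>)"]) (auto simp: T_def k_def)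
  qed
  have "pcoeff (f * g * h) \<alpha> = (\<Sum>(x, \<delta>)\<in>P (f * g) h \<alpha>. pcoeff (f * g) x * pcoeff h \<delta>)"
    unfolding pcoeff_times_pairs[of "f * g"] P_def ..
  also have "\<dots> = (\<Sum>(x, \<delta>)\<in>k ` T. pcoeff (f * g) x * pcoeff h \<delta>)"
    by (rule sum.mono_neutral_left) (use finT sub in \<open>auto simp: T_def k_def P_def\<close>)
  also have "\<dots> = (\<Sum>q\<in>k ` T. sum F {t \<in> T. k t = q})"
  proof (rule sum.cong[OF refl])
    fix q assume "q \<in> k ` T"
    then obtain x \<delta> where q: "q = (x, \<delta>)" "x + \<delta> = \<alpha>" "pcoeff h \<delta> \<noteq> 0"
      by (auto simp: T_def k_def)
    have "pcoeff (f * g) x * pcoeff h \<delta> = (\<Sum>(\<beta>, \<gamma>)\<in>P f g x. pcoeff f \<beta> * pcoeff g \<gamma> * pcoeff h \<delta>)"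
      unfolding pcoeff_times_pairs P_def sum_distrib_right by (simp add: case_prod_unfold)
    also have "\<dots> = sum F {t \<in> T. k t = q}"
      by (rule sum.reindex_bij_witness[of _ "\<lambda>(\<beta>, \<gamma>, _). (\<beta>, \<gamma>)" "\<lambda>(\<beta>, \<gamma>). (\<beta>, \<gamma>, \<delta>)"])
        (use q in \<open>auto simp: T_def k_def P_def F_def\<close>)
    finally show "(case q of (x, \<delta>) \<Rightarrow> pcoeff (f * g) x * pcoeff h \<delta>) = sum F {t \<in> T. k t = q}"
      using q by simp
  qed
  also have "\<dots> = sum F T"
    by (rule sum.group) (use finT in auto)
  finally show ?thesis unfolding F_def T_def .
qed

instance puiseux :: comm_ring_1
proof
  fix f g h :: puiseux
  show comm: "f * g = g * f" for f g :: puiseux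
    by (rule pcoeff_eqI, unfold pcoeff_times_pairs)
      (rule sum.reindex_bij_witness[of _ prod.swap prod.swap]; auto simp: mult.commute)
  have cyc: "f * g * h = g * h * f"
    by (rule pcoeff_eqI, unfold pcoeff_times_triples)
      (rule sum.reindex_bij_witness[of _ "\<lambda>(b, c, a). (a, b, c)" "\<lambda>(a, b, c). (b, c, a)"]; auto)
  show "f * g * h = f * (g * h)"
    using cyc comm by simp
  show "1 * f = f"
  proof (rule pcoeff_eqI)
    fix \<alpha>
    show "pcoeff (1 * f) \<alpha> = pcoeff f \<alpha>"
      by (subst pcoeff_times[of "{0}"]) (auto simp: pcoeff_one split: if_splits)
  qed
  show "(f + g) * h = f * h + g * h"
  proof (rule pcoeff_eqI)
    fix \<alpha>
    let ?A = "{\<beta>. pcoeff f \<beta> \<noteq> 0 \<and> pcoeff h (\<alpha> - \<beta>) \<noteq> 0} \<union> {\<beta>. pcoeff g \<beta> \<noteq> 0 \<and> pcoeff h (\<alpha> - \<beta>) \<noteq> 0}"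
    have fin: "finite ?A" by (simp add: finite_times_index)
    have "pcoeff (f * h) \<alpha> = (\<Sum>\<beta>\<in>?A. pcoeff f \<beta> * pcoeff h (\<alpha> - \<beta>))"
      "pcoeff (g * h) \<alpha> = (\<Sum>\<beta>\<in>?A. pcoeff g \<beta> * pcoeff h (\<alpha> - \<beta>))"
      "pcoeff ((f + g) * h) \<alpha> = (\<Sum>\<beta>\<in>?A. pcoeff (f + g) \<beta> * pcoeff h (\<alpha> - \<beta>))"
      by (rule pcoeff_times[OF fin]; auto)+
    then show "pcoeff ((f + g) * h) \<alpha> = pcoeff (f * h + g * h) \<alpha>"
      by (simp add: algebra_simps sum.distrib)
  qed
  show "(0::puiseux) \<noteq> 1"
    using pcoeff_one[of 0] by (metis pcoeff_simps(1) zero_neq_one)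
qed (rule pcoeff_eqI; simp)+

text \<open>The exponent of the leading term; only meaningful for nonzero series.\<close>

definition lead_exp :: "puiseux \<Rightarrow> real" where
  "lead_exp f = (GREATEST \<alpha>. pcoeff f \<alpha> \<noteq> 0)"

lemma lead_exp_eqI:
  "pcoeff f m \<noteq> 0 \<Longrightarrow> (\<And>\<alpha>. m < \<alpha> \<Longrightarrow> pcoeff f \<alpha> = 0) \<Longrightarrow> lead_exp f = m"
  unfolding lead_exp_def by (rule Greatest_equality) (auto simp: not_less[symmetric])

lemma lead_exp:
  assumes "f \<noteq> 0"
  shows "pcoeff f (lead_exp f) \<noteq> 0" and "\<And>\<alpha>. lead_exp f < \<alpha> \<Longrightarrow> pcoeff f \<alpha> = 0"
proof -
  obtain y where y: "pcoeff f y \<noteq> 0" using assms pcoeff_eqI[of f 0] by auto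
  let ?A = "{\<alpha>. pcoeff f \<alpha> \<noteq> 0} \<inter> {y..}"
  have fin: "finite ?A" by (rule puiseux_exponents_finite[OF pcoeff_exponents])
  then have m: "Max ?A \<in> ?A" using y by (intro Max_in) auto
  have z: "pcoeff f \<alpha> = 0" if "Max ?A < \<alpha>" for \<alpha>
  proof (rule ccontr)
    assume "pcoeff f \<alpha> \<noteq> 0"
    then have "\<alpha> \<in> ?A" using m that by auto
    then have "\<alpha> \<le> Max ?A" using fin by (rule Max_ge[rotated])
    with that show False by simp
  qed
  have nz: "pcoeff f (Max ?A) \<noteq> 0" using m by simp
  have eq: "lead_exp f = Max ?A" using nz z by (rule lead_exp_eqI)
  show "pcoeff f (lead_exp f) \<noteq> 0" unfolding eq by (rule nz)
  show "pcoeff f \<alpha> = 0" if "lead_exp f < \<alpha>" for \<alpha>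
    using that unfolding eq by (rule z)
qed

lemma pcoeff_times_top:
  assumes "\<And>\<alpha>. m < \<alpha> \<Longrightarrow> pcoeff f \<alpha> = 0" "\<And>\<alpha>. n < \<alpha> \<Longrightarrow> pcoeff g \<alpha> = 0"
  shows "pcoeff (f * g) (m + n) = pcoeff f m * pcoeff g n"
    and "\<And>\<alpha>. m + n < \<alpha> \<Longrightarrow> pcoeff (f * g) \<alpha> = 0"
proof -
  have "\<beta> \<in> {m}" if "pcoeff f \<beta> \<noteq> 0" "pcoeff g (m + n - \<beta>) \<noteq> 0" for \<beta>
    using assms(1)[of \<beta>] assms(2)[of "m + n - \<beta>"] that by force
  then show "pcoeff (f * g) (m + n) = pcoeff f m * pcoeff g n"
    by (subst pcoeff_times[of "{m}"]) auto
  fix \<alpha> assume a: "m + n < \<alpha>"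
  have "\<beta> \<in> {}" if "pcoeff f \<beta> \<noteq> 0" "pcoeff g (\<alpha> - \<beta>) \<noteq> 0" for \<beta>
    using assms(1)[of \<beta>] assms(2)[of "\<alpha> - \<beta>"] that a by force
  then show "pcoeff (f * g) \<alpha> = 0"
    by (subst pcoeff_times[of "{}"]) auto
qed

lemma pcoeff_sum: "pcoeff (sum F A) \<alpha> = (\<Sum>i\<in>A. pcoeff (F i) \<alpha>)"
  by (induction A rule: infinite_finite_induct) auto

lemma pcoeff_times_cong:
  assumes u: "\<And>\<alpha>. 0 < \<alpha> \<Longrightarrow> pcoeff u \<alpha> = 0" and h: "\<And>\<beta>. \<alpha> \<le> \<beta> \<Longrightarrow> pcoeff h \<beta> = pcoeff h' \<beta>"
  shows "pcoeff (u * h) \<alpha> = pcoeff (u * h') \<alpha>"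
proof -
  let ?A = "{\<beta>. pcoeff u \<beta> \<noteq> 0 \<and> pcoeff h (\<alpha> - \<beta>) \<noteq> 0} \<union> {\<beta>. pcoeff u \<beta> \<noteq> 0 \<and> pcoeff h' (\<alpha> - \<beta>) \<noteq> 0}"
  have fin: "finite ?A" by (simp add: finite_times_index)
  have "pcoeff (u * h) \<alpha> = (\<Sum>\<beta>\<in>?A. pcoeff u \<beta> * pcoeff h (\<alpha> - \<beta>))"
    by (rule pcoeff_times[OF fin]) auto
  also have "\<dots> = (\<Sum>\<beta>\<in>?A. pcoeff u \<beta> * pcoeff h' (\<alpha> - \<beta>))"
  proof (rule sum.cong[OF refl])
    fix \<beta> assume "\<beta> \<in> ?A"
    then have "\<beta> \<le> 0" using u[of \<beta>] by force
    then show "pcoeff u \<beta> * pcoeff h (\<alpha> - \<beta>) = pcoeff u \<beta> * pcoeff h' (\<alpha> - \<beta>)" using h by simp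
  qed
  also have "\<dots> = pcoeff (u * h') \<alpha>"
    by (rule pcoeff_times[OF fin, symmetric]) auto
  finally show ?thesis .
qed

lemma puiseux_inverse_exists:
  assumes "f \<noteq> 0"
  obtains g :: puiseux where "g * f = 1"
proof -
  define m c where "m = lead_exp f" and "c = pcoeff f m"
  define s where "s = Abs_puiseux (\<lambda>\<alpha>. if \<alpha> = - m then 1 / c else 0)"
  have s: "pcoeff s = (\<lambda>\<alpha>. if \<alpha> = - m then 1 / c else 0)"
    unfolding s_def by (rule Abs_puiseux_inverse) (simp add: puiseux_exponents_def)
  have c: "c \<noteq> 0" using lead_exp(1)[OF assms] by (simp add: c_def m_def)
  define u where "u = s * f"
  have u0: "pcoeff u 0 = 1" and u: "\<And>\<alpha>. 0 < \<alpha> \<Longrightarrow> pcoeff u \<alpha> = 0"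
    using pcoeff_times_top[of "- m" s m f] lead_exp(2)[OF assms] c
    by (auto simp: s u_def m_def c_def)
  define g where "g = 1 - u"
  have g: "pcoeff g \<alpha> = 0" if "0 \<le> \<alpha>" for \<alpha>
    using that u0 u[of \<alpha>] by (cases "\<alpha> = 0") (auto simp: g_def pcoeff_one)
  obtain e where e: "e > 0" "\<And>\<alpha>. - e < \<alpha> \<Longrightarrow> pcoeff g \<alpha> = 0"
  proof (cases "g = 0")
    case True
    then show ?thesis by (intro that[of 1]) auto
  next
    case False
    then show ?thesis
      by (intro that[of "- lead_exp g"]) (use lead_exp[OF False] g[of "lead_exp g"] in \<open>auto simp: not_le[symmetric]\<close>)
  qed
  have gn: "pcoeff (g ^ n) \<alpha> = 0" if "- (real n * e) < \<alpha>" for n \<alpha>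
    using that
  proof (induction n arbitrary: \<alpha>)
    case 0
    then show ?case by (simp add: pcoeff_one)
  next
    case (Suc n)
    show ?case
      using pcoeff_times_top(2)[of "- e" g "- (real n * e)" "g ^ n" \<alpha>] e Suc
      by (simp add: algebra_simps)
  qed
  define N where "N \<alpha> = nat \<lceil>- \<alpha> / e\<rceil>" for \<alpha>
  have N: "- (real n * e) < \<alpha>" if "N \<alpha> < n" for n \<alpha>
  proof -
    have "- \<alpha> / e < real n" using that unfolding N_def by linarith
    then show ?thesis using e(1) by (simp add: field_simps)
  qed
  have Nmono: "N \<beta> \<le> N \<alpha>" if "\<alpha> \<le> \<beta>" for \<alpha> \<beta>
    unfolding N_def using that e(1) by (intro nat_mono ceiling_mono) (simp add: field_simps)
  define H where "H k = (\<Sum>n\<le>k. g ^ n)" for k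
  define hc where "hc \<alpha> = pcoeff (H (N \<alpha>)) \<alpha>" for \<alpha>
  have hc: "hc \<alpha> = pcoeff (H k) \<alpha>" if "N \<alpha> \<le> k" for \<alpha> k
    unfolding hc_def H_def pcoeff_sum
    by (rule sum.mono_neutral_left) (use that N gn in auto)
  have "puiseux_exponents {\<alpha>. hc \<alpha> \<noteq> 0}"
    unfolding puiseux_exponents_iff
  proof
    fix b
    have "{\<alpha>. hc \<alpha> \<noteq> 0} \<inter> {b..} \<subseteq> {\<alpha>. pcoeff (H (N b)) \<alpha> \<noteq> 0} \<inter> {b..}"
      using hc[of _ "N b"] Nmono[of b] by auto
    then show "finite ({\<alpha>. hc \<alpha> \<noteq> 0} \<inter> {b..})"
      by (rule finite_subset) (rule puiseux_exponents_finite[OF pcoeff_exponents])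
  qed
  then have h: "pcoeff (Abs_puiseux hc) = hc" by (simp add: Abs_puiseux_inverse)
  have "u * Abs_puiseux hc = 1"
  proof (rule pcoeff_eqI)
    fix \<alpha>
    have "pcoeff (u * Abs_puiseux hc) \<alpha> = pcoeff (u * H (N \<alpha>)) \<alpha>"
      by (rule pcoeff_times_cong[OF u]) (simp_all add: h hc Nmono)
    also have "u * H (N \<alpha>) = 1 - g ^ Suc (N \<alpha>)"
      unfolding H_def using one_diff_power_eq[of g "Suc (N \<alpha>)"]
      by (simp add: g_def lessThan_Suc_atMost)
    also have "pcoeff \<dots> \<alpha> = pcoeff 1 \<alpha>"
      using gn[OF N, of \<alpha> "Suc (N \<alpha>)"] by simp
    finally show "pcoeff (u * Abs_puiseux hc) \<alpha> = pcoeff 1 \<alpha>" .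
  qed
  then have "(s * Abs_puiseux hc) * f = 1" by (simp add: u_def mult_ac)
  then show ?thesis by (rule that)
qed

instantiation puiseux :: field
begin

definition inverse_puiseux :: "puiseux \<Rightarrow> puiseux" where
  "inverse (f :: puiseux) = (if f = 0 then 0 else THE g. g * f = 1)"

definition divide_puiseux :: "puiseux \<Rightarrow> puiseux \<Rightarrow> puiseux" where
  "f div (g :: puiseux) = f * inverse g"

instance
proof
  fix f g :: puiseux
  show "inverse f * f = 1" if f: "f \<noteq> 0"
  proof -
    obtain g where g: "g * f = 1" using puiseux_inverse_exists[OF f] .
    have "k = g" if k: "k * f = 1" for k
    proof -
      have "k = k * (g * f)" using g by simp
      also have "\<dots> = g * (k * f)" by (simp only: mult_ac)
      finally show "k = g" using k by simp
    qed
    with g have "(THE g. g * f = 1) = g" by (rule the_equality)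
    then show ?thesis using f g by (simp add: inverse_puiseux_def)
  qed
qed (simp_all add: inverse_puiseux_def divide_puiseux_def)

end

definition puiseux_positive :: "puiseux \<Rightarrow> bool" where
  "puiseux_positive f \<longleftrightarrow> f \<noteq> 0 \<and> pcoeff f (lead_exp f) > 0"

lemma puiseux_positive_iff:
  "puiseux_positive f \<longleftrightarrow> (\<exists>m. pcoeff f m > 0 \<and> (\<forall>\<alpha>>m. pcoeff f \<alpha> = 0))"
proof
  assume "puiseux_positive f"
  then show "\<exists>m. pcoeff f m > 0 \<and> (\<forall>\<alpha>>m. pcoeff f \<alpha> = 0)"
    using lead_exp[of f] by (auto simp: puiseux_positive_def)
next
  assume "\<exists>m. pcoeff f m > 0 \<and> (\<forall>\<alpha>>m. pcoeff f \<alpha> = 0)"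
  then obtain m where m: "pcoeff f m > 0" "\<forall>\<alpha>>m. pcoeff f \<alpha> = 0" by blast
  then have "lead_exp f = m" by (intro lead_exp_eqI) auto
  moreover have "f \<noteq> 0" using m by auto
  ultimately show "puiseux_positive f" using m by (simp add: puiseux_positive_def)
qed

lemma puiseux_positive_add:
  assumes "puiseux_positive f" "puiseux_positive g"
  shows "puiseux_positive (f + g)"
proof -
  obtain m n where m: "pcoeff f m > 0" "\<forall>\<alpha>>m. pcoeff f \<alpha> = 0"
    and n: "pcoeff g n > 0" "\<forall>\<alpha>>n. pcoeff g \<alpha> = 0"
    using assms unfolding puiseux_positive_iff by blast
  have "pcoeff (f + g) (max m n) > 0"
  proof (cases m n rule: linorder_cases)
    case less
    then show ?thesis using m n by (simp add: max_def)
  next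
    case equal
    then show ?thesis using m n by simp
  next
    case greater
    then show ?thesis using m n by (simp add: max_def)
  qed
  moreover have "pcoeff (f + g) \<alpha> = 0" if "max m n < \<alpha>" for \<alpha>
    using m n that by simp
  ultimately show ?thesis unfolding puiseux_positive_iff by blast
qed

lemma puiseux_positive_mult:
  assumes "puiseux_positive f" "puiseux_positive g"
  shows "puiseux_positive (f * g)"
proof -
  obtain m n where m: "pcoeff f m > 0" "\<forall>\<alpha>>m. pcoeff f \<alpha> = 0"
    and n: "pcoeff g n > 0" "\<forall>\<alpha>>n. pcoeff g \<alpha> = 0"
    using assms unfolding puiseux_positive_iff by blast
  show ?thesis unfolding puiseux_positive_iff
    by (rule exI[of _ "m + n"]) (use pcoeff_times_top[of m f n g] m n in auto)
qed

lemma puiseux_positive_cases: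
  assumes "f \<noteq> 0"
  shows "puiseux_positive f \<or> puiseux_positive (- f)"
proof -
  consider "pcoeff f (lead_exp f) > 0" | "pcoeff f (lead_exp f) < 0"
    using lead_exp(1)[OF assms] by linarith
  then show ?thesis
    unfolding puiseux_positive_iff using lead_exp(2)[OF assms]
    by cases (auto intro!: exI[of _ "lead_exp f"])
qed

lemma not_puiseux_positive_0: "\<not> puiseux_positive 0"
  by (simp add: puiseux_positive_def)

instantiation puiseux :: linordered_field
begin

definition less_puiseux :: "puiseux \<Rightarrow> puiseux \<Rightarrow> bool" where
  "f < g \<longleftrightarrow> puiseux_positive (g - f)"

definition less_eq_puiseux :: "puiseux \<Rightarrow> puiseux \<Rightarrow> bool" where
  "f \<le> g \<longleftrightarrow> f < g \<or> f = (g :: puiseux)"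

definition abs_puiseux :: "puiseux \<Rightarrow> puiseux" where
  "\<bar>f :: puiseux\<bar> = (if f < 0 then - f else f)"

definition sgn_puiseux :: "puiseux \<Rightarrow> puiseux" where
  "sgn (f :: puiseux) = (if f = 0 then 0 else if 0 < f then 1 else - 1)"

instance
proof
  fix f g h :: puiseux
  have irr: "\<not> f < f" for f :: puiseux by (simp add: less_puiseux_def not_puiseux_positive_0)
  have tr: "f < h" if "f < g" "g < h" for f g h :: puiseux
    using puiseux_positive_add[of "g - f" "h - g"] that by (simp add: less_puiseux_def)
  show "f < g \<longleftrightarrow> f \<le> g \<and> \<not> g \<le> f"
    using irr tr by (auto simp: less_eq_puiseux_def)
  show "f \<le> f" by (simp add: less_eq_puiseux_def)
  show "f \<le> h" if "f \<le> g" "g \<le> h" using that tr by (auto simp: less_eq_puiseux_def)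
  show "f = g" if "f \<le> g" "g \<le> f" using that tr[of f g f] irr[of f] by (auto simp: less_eq_puiseux_def)
  show "f \<le> g \<or> g \<le> f"
    using puiseux_positive_cases[of "g - f"] by (auto simp: less_eq_puiseux_def less_puiseux_def)
  show "h + f \<le> h + g" if "f \<le> g"
    using that by (auto simp: less_eq_puiseux_def less_puiseux_def)
  show "h * f < h * g" if "f < g" "0 < h"
    using puiseux_positive_mult[of h "g - f"] that by (simp add: less_puiseux_def right_diff_distrib)
  show "\<bar>f\<bar> = (if f < 0 then - f else f)" by (rule abs_puiseux_def)
  show "sgn f = (if f = 0 then 0 else if 0 < f then 1 else - 1)" by (rule sgn_puiseux_def)
qed

end

lemma puiseux_pos_iff: "0 < f \<longleftrightarrow> puiseux_positive f"
  by (simp add: less_puiseux_def)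

definition sval :: "puiseux \<Rightarrow> symtrop" where
  "sval f =
    (if f > 0 then TPos (lead_exp f) else if f = 0 then TZero else TNeg (lead_exp f))"

definition sval_vec :: "puiseux ^ 'n \<Rightarrow> symtrop ^ 'n" where
  "sval_vec x = (\<chi> i. sval (x $ i))"

text \<open>
  Convexity over an ordered field; the library's \<^const>\<open>convex\<close> is tied to real scalars.
\<close>

definition field_convex :: "('a::linordered_field ^ 'n) set \<Rightarrow> bool" where
  "field_convex S \<longleftrightarrow>
    (\<forall>x\<in>S. \<forall>y\<in>S. \<forall>u v. 0 \<le> u \<longrightarrow> 0 \<le> v \<longrightarrow> u + v = 1 \<longrightarrow> u *s x + v *s y \<in> S)"

end

theory Submission
  imports Defs
begin

text \<open>
  Let the origin lie outside of a TC-hemispace \<open>Q\<close> (otherwise exchange \<open>Q\<close> with its complement), and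
  pass to homogeneous coordinates, so that \<open>Q\<close> and its complement become complementary cones
  \<open>P\<close> and \<open>N\<close>. Both are closed under the left sum (tropical addition with ties resolved in favour of
  the left summand) and under the elimination of a single coordinate in which two vectors are
  opposite. After flipping signs, every coordinate axis either has its positive half in \<open>P\<close> and its
  negative half in \<open>N\<close>, or is irrelevant. Whether \<open>a e\<^sub>i \<ominus> b e\<^sub>j\<close> lies in \<open>P\<close> defines a relation
  between signed monomials which elimination makes transitive and cotransitive, and the left sum
  shows that a vector lies in \<open>P\<close> iff some positive entry outweighs all of its negative entries.

  For such a relation a convex lift can be written down. Two monomials that outweigh each other
  can be cancelled against each other; after rescaling the coordinates all such ties occur at equal
  norms, and one takes the Puiseux vectors \<open>z\<close> such that, among the sums of the entries of \<open>z\<close> over the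
  tie classes, some positive one outweighs all negative ones. Ties in which neither monomial outweighs the other need no
  care, since there the whole preimage under the signed valuation is convex.
\<close>

section \<open>Leading exponents and sums of Puiseux series\<close>

lemma lead_exp_mult:
  assumes "f \<noteq> 0" "g \<noteq> 0"
  shows "lead_exp (f * g) = lead_exp f + lead_exp g"
proof (rule lead_exp_eqI)
  show "pcoeff (f * g) (lead_exp f + lead_exp g) \<noteq> 0"
    using lead_exp[OF assms(1)] lead_exp[OF assms(2)] by (subst pcoeff_times_top(1)) auto
  show "pcoeff (f * g) \<alpha> = 0" if "lead_exp f + lead_exp g < \<alpha>" for \<alpha>
    using lead_exp[OF assms(1)] lead_exp[OF assms(2)] that by (intro pcoeff_times_top(2)) auto
qed

lemma lead_exp_uminus [simp]: "lead_exp (- f) = lead_exp f"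
  by (simp add: lead_exp_def)

lemma lead_exp_one: "lead_exp 1 = 0"
  by (rule lead_exp_eqI) (auto simp: pcoeff_one)

lemma pcoeff_of_nat_mult: "pcoeff (of_nat n * f) \<alpha> = real n * pcoeff f \<alpha>"
  by (induction n) (simp_all add: distrib_right)

lemma of_nat_mult_less_of_lead_exp_less:
  assumes "0 < f" "0 < g" "lead_exp f < lead_exp g"
  shows "of_nat n * f < g"
proof -
  have "g \<noteq> 0" "f \<noteq> 0" using assms by auto
  have "puiseux_positive g" using assms by (simp add: puiseux_pos_iff)
  then have "0 < pcoeff g (lead_exp g)" by (simp add: puiseux_positive_def)
  then have "puiseux_positive (g - of_nat n * f)"
    using lead_exp(2)[OF \<open>g \<noteq> 0\<close>] lead_exp(2)[OF \<open>f \<noteq> 0\<close>] assms(3)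
    unfolding puiseux_positive_iff
    by (intro exI[of _ "lead_exp g"]) (simp add: pcoeff_of_nat_mult)
  then show ?thesis by (simp add: less_puiseux_def)
qed

lemma lead_exp_le_of_le_of_nat_mult:
  assumes "0 < f" "0 < g" "f \<le> of_nat n * g"
  shows "lead_exp f \<le> lead_exp g"
  using of_nat_mult_less_of_lead_exp_less[OF assms(2,1), of n] assms(3) by force

lemma lead_exp_mono: "0 < f \<Longrightarrow> f \<le> g \<Longrightarrow> lead_exp f \<le> lead_exp g"
  using lead_exp_le_of_le_of_nat_mult[of f g 1] by auto

text \<open>If all positive terms had smaller leading exponents than the sum \<open>s > 0\<close>,
  every natural multiple of a term would be at most \<open>s\<close>. The multiple
  \<open>card B + 1\<close>, added up over \<open>B\<close>, gives
  \<open>(card B + 1) * s <= card B * s\<close>, which is absurd.\<close>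

lemma sum_pos_dominating_term:
  fixes w :: "'i \<Rightarrow> puiseux"
  assumes "finite B" "0 < sum w B"
  shows "\<exists>k\<in>B. 0 < w k \<and> lead_exp (sum w B) \<le> lead_exp (w k)"
proof (rule ccontr)
  assume "\<not> ?thesis"
  then have *: "lead_exp (w k) < lead_exp (sum w B)" if "k \<in> B" "0 < w k" for k
    using that by (meson not_le)
  let ?n = "Suc (card B)"
  have "of_nat ?n * w k \<le> sum w B" if "k \<in> B" for k
  proof (cases "0 < w k")
    case True
    then show ?thesis
      using of_nat_mult_less_of_lead_exp_less[OF True assms(2) *[OF that True]] less_imp_le by blast
  next
    case False
    then have "of_nat ?n * w k \<le> 0" by (intro mult_nonneg_nonpos) auto
    with assms(2) show ?thesis by simp
  qed
  then have "(\<Sum>k\<in>B. of_nat ?n * w k) \<le> of_nat (card B) * sum w B"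
    by (rule sum_bounded_above)
  then have "of_nat ?n * sum w B \<le> of_nat (card B) * sum w B"
    by (simp add: sum_distrib_left)
  with assms(2) show False by (simp add: distrib_right)
qed

lemma add_neg_dominating_term:
  fixes f g :: puiseux
  assumes "f + g < 0"
  shows "f < 0 \<and> lead_exp (f + g) \<le> lead_exp f \<or> g < 0 \<and> lead_exp (f + g) \<le> lead_exp g"
proof -
  have eq: "lead_exp (- g - f) = lead_exp (f + g)"
    by (metis add.commute lead_exp_uminus minus_add_distrib diff_conv_add_uminus)
  \<comment> \<open>The two negated summands are treated as a family indexed by
    \<open>bool\<close>.\<close>
  show ?thesis
    using sum_pos_dominating_term[of UNIV "\<lambda>b. if b then - f else - g"] assms
    by (auto simp: UNIV_bool eq)
qed

text \<open>Replacing the term \<open>w j\<close> by minus the total turns the total into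
  \<open>- w j > 0\<close>. Some positive term dominates the new total, and by \<open>dom\<close> it
  can only be the replaced one.\<close>

lemma sum_neg_of_dominating_term:
  fixes w :: "'i \<Rightarrow> puiseux"
  assumes B: "finite B" "j \<in> B" and neg: "w j < 0"
    and dom: "\<And>l. l \<in> B \<Longrightarrow> 0 < w l \<Longrightarrow> lead_exp (w l) < lead_exp (w j)"
  shows "sum w B < 0" and "lead_exp (w j) \<le> lead_exp (sum w B)"
proof -
  define w' where "w' = w(j := - sum w B)"
  have "sum w' (B - {j}) = sum w (B - {j})"
    unfolding w'_def by (rule sum.cong) auto
  then have w': "sum w' B = - w j"
    using sum.remove[OF B, of w] sum.remove[OF B, of w'] by (simp add: w'_def)
  then obtain k where k: "k \<in> B" "0 < w' k" "lead_exp (- w j) \<le> lead_exp (w' k)"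
    using sum_pos_dominating_term[of B w'] B neg by auto
  have "k = j" using dom[of k] k by (fastforce simp: w'_def split: if_splits)
  with k show "sum w B < 0" "lead_exp (w j) \<le> lead_exp (sum w B)" by (simp_all add: w'_def)
qed

section \<open>Signed valuation of products and monomials\<close>

lemma sval_eq_simps:
  "sval f = TPos a \<longleftrightarrow> 0 < f \<and> lead_exp f = a"
  "sval f = TNeg a \<longleftrightarrow> f < 0 \<and> lead_exp f = a"
  "sval f = TZero \<longleftrightarrow> f = 0"
  "sval f \<noteq> TBal a"
  by (auto simp: sval_def)

lemma tsigned_iff: "x \<in> tsigned \<longleftrightarrow> (\<forall>r. x \<noteq> TBal r)"
  by (cases x) (auto simp: tsigned_def tpositive_def tnegative_def)

lemma tnegative_iff: "x \<in> tnegative \<longleftrightarrow> (\<exists>r. x = TNeg r)"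
  by (auto simp: tnegative_def)

lemma sval_signed: "sval f \<in> tsigned"
  by (simp add: tsigned_iff sval_eq_simps)

lemma sval_one: "sval 1 = 1"
  by (simp add: sval_eq_simps one_symtrop_def lead_exp_one)

lemma sval_mult: "sval (f * g) = sval f * sval g"
proof -
  consider "f = 0" | "g = 0" | "0 < f" "0 < g" | "0 < f" "g < 0" | "f < 0" "0 < g" | "f < 0" "g < 0"
    by fastforce
  then show ?thesis
  proof cases
    case 3
    then show ?thesis by (simp add: sval_def lead_exp_mult mult_pos_pos)
  next
    case 4
    then have "f * g < 0" by (rule mult_pos_neg)
    with 4 show ?thesis by (simp add: sval_def lead_exp_mult not_less_iff_gr_or_eq)
  next
    case 5
    then have "f * g < 0" by (rule mult_neg_pos)
    with 5 show ?thesis by (simp add: sval_def lead_exp_mult not_less_iff_gr_or_eq)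
  next
    case 6
    then have "0 < f * g" by (rule mult_neg_neg)
    with 6 show ?thesis by (simp add: sval_def lead_exp_mult not_less_iff_gr_or_eq)
  qed (cases "sval f"; simp add: sval_def)+
qed

lemma sval_uminus: "sval (- f) = TNeg 0 * sval f"
  by (auto simp: sval_def)

lift_definition pmonom :: "real \<Rightarrow> puiseux" is "\<lambda>a \<alpha>. if \<alpha> = a then 1 else 0"
  by (simp add: puiseux_exponents_def)

lemma lead_exp_pmonom [simp]: "lead_exp (pmonom a) = a"
  by (rule lead_exp_eqI; transfer) auto

lemma pmonom_pos [simp]: "0 < pmonom a"
  unfolding puiseux_pos_iff puiseux_positive_iff by (rule exI[of _ a], transfer) auto

lemma pmonom_mono: "a \<le> b \<Longrightarrow> pmonom a \<le> pmonom b"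
  using of_nat_mult_less_of_lead_exp_less[of "pmonom a" "pmonom b" 1] by (cases "a = b") auto

lemma sval_pmonom: "sval (pmonom a) = TPos a"
  by (simp add: sval_eq_simps)

lemma pmonom_mult: "pmonom a * pmonom b = pmonom (a + b)"
proof (rule pcoeff_eqI)
  fix \<alpha>
  have c: "pcoeff (pmonom a) \<beta> = (if \<beta> = a then 1 else 0)" for a \<beta> by transfer simp
  show "pcoeff (pmonom a * pmonom b) \<alpha> = pcoeff (pmonom (a + b)) \<alpha>"
    by (subst pcoeff_times[of "{a}"]) (auto simp: c split: if_splits)
qed

lemma pmonom_zero: "pmonom 0 = 1"
  by transfer simp

lemma pmonom_mult_cancel [simp]:
  "pmonom (- a) * (pmonom a * f) = f" "pmonom a * (pmonom (- a) * f) = f"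
  by (simp_all add: mult.assoc[symmetric] pmonom_mult pmonom_zero)

section \<open>Dominance orders on signed monomials and their lifts\<close>

text \<open>
  \<open>R i a j b\<close> says that a positive term of norm \<open>a\<close> in coordinate \<open>i\<close> outweighs a
  negative term of norm \<open>b\<close> in coordinate \<open>j\<close>. The relation need not be antisymmetric: \<open>R i a j b\<close>
  and \<open>R j b i a\<close> may hold together (a tie that the positive sign wins) or fail together (a tie that
  the negative sign wins).
\<close>

locale dominance =
  fixes A :: "'i::finite set" and R :: "'i \<Rightarrow> real \<Rightarrow> 'i \<Rightarrow> real \<Rightarrow> bool"
  assumes mono: "\<lbrakk>i \<in> A; j \<in> A; i \<noteq> j; R i a j b; a \<le> a'; b' \<le> b\<rbrakk> \<Longrightarrow> R i a' j b'"
    and shift: "\<lbrakk>i \<in> A; j \<in> A; i \<noteq> j; R i a j b\<rbrakk> \<Longrightarrow> R i (a + c) j (b + c)"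
    and trans: "\<lbrakk>i \<in> A; j \<in> A; k \<in> A; i \<noteq> j; j \<noteq> k; i \<noteq> k; R i a j b; R j b k c\<rbrakk> \<Longrightarrow> R i a k c"
    and cotrans: "\<lbrakk>i \<in> A; j \<in> A; k \<in> A; i \<noteq> j; j \<noteq> k; i \<noteq> k; R i a k c; \<not> R j b k c\<rbrakk> \<Longrightarrow> R i a j b"
    and cycle: "\<lbrakk>i \<in> A; j \<in> A; i \<noteq> j; R i a j b; R j b i a'\<rbrakk> \<Longrightarrow> a' \<le> a"
    and cocycle: "\<lbrakk>i \<in> A; j \<in> A; i \<noteq> j; \<not> R i a j b; \<not> R j b i a'\<rbrakk> \<Longrightarrow> a \<le> a'"

text \<open>Negating and reversing the relation exchanges \<open>trans\<close> with
  \<open>cotrans\<close> and \<open>cycle\<close> with \<open>cocycle\<close>. The lifting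
  construction thereby serves both cones.\<close>

lemma dominance_dual:
  assumes "dominance A R"
  shows "dominance A (\<lambda>i a j b. \<not> R j b i a)"
proof -
  interpret dominance A R by fact
  show ?thesis
  proof (unfold_locales, goal_cases)
    case (1 i j a b a' b')
    then show ?case using mono[of j i b' a' b a] by auto
  next
    case (2 i j a b c)
    then show ?case using shift[of j i "b + c" "a + c" "- c"] by auto
  next
    case (3 i j k a b c)
    then show ?case using cotrans[of k j i c a b] by auto
  next
    case (4 i j k a c b)
    then show ?case using trans[of k j i c b a] by auto
  next
    case (5 i j a b a')
    then show ?case using cocycle[of i j a' b a] by auto
  next
    case (6 i j a b a')
    then show ?case using cycle[of i j a' b a] by auto
  qed
qed

text \<open>\<open>R\<close> is queried at \<open>i \<noteq> j\<close> only, since an entry is not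
  both positive and negative. Entries outside \<open>A\<close> are arbitrary signed numbers.\<close>

definition dominated :: "'i set \<Rightarrow> ('i \<Rightarrow> real \<Rightarrow> 'i \<Rightarrow> real \<Rightarrow> bool) \<Rightarrow> ('i \<Rightarrow> symtrop) set" where
  "dominated A R = {x. (\<forall>k. x k \<in> tsigned) \<and>
     (\<exists>i\<in>A. \<exists>a. x i = TPos a \<and> (\<forall>j\<in>A. \<forall>b. x j = TNeg b \<longrightarrow> R i a j b))}"

text \<open>If all alternatives fail, take a positive entry that outweighs the most negative
  entries. It misses some negative entry \<open>j\<close>, and a positive entry outweighing
  \<open>j\<close> also outweighs all that the first one does, by \<open>cotrans\<close> through
  \<open>j\<close> and then \<open>trans\<close>. This contradicts maximality.\<close>

lemma (in dominance) dominated_cases: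
  assumes x: "\<And>k. x k \<in> tsigned"
  shows "(\<forall>k\<in>A. x k = TZero) \<or> x \<in> dominated A R \<or>
    (\<exists>j\<in>A. \<exists>b. x j = TNeg b \<and> (\<forall>i\<in>A. \<forall>a. x i = TPos a \<longrightarrow> \<not> R i a j b))"
proof (rule ccontr)
  assume "\<not> ?thesis"
  then have nz: "\<exists>k\<in>A. x k \<noteq> TZero" and np: "x \<notin> dominated A R"
    and nn: "\<And>j b. j \<in> A \<Longrightarrow> x j = TNeg b \<Longrightarrow> \<exists>i\<in>A. \<exists>a. x i = TPos a \<and> R i a j b"
    by simp_all
  have np': "\<exists>j\<in>A. \<exists>b. x j = TNeg b \<and> \<not> R i a j b" if "i \<in> A" "x i = TPos a" for i a
    using np x that unfolding dominated_def by blast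
  define U where "U i a = {j \<in> A. \<exists>b. x j = TNeg b \<and> R i a j b}" for i a
  define I where "I = {(i, a). i \<in> A \<and> x i = TPos a}"
  have "I \<subseteq> (\<lambda>i. (i, THE a. x i = TPos a)) ` A" by (auto simp: I_def)
  then have "finite I" by (rule finite_subset) simp
  obtain k where "k \<in> A" "x k \<noteq> TZero" using nz by blast
  then have "I \<noteq> {}" using nn[of k] x[of k] by (cases "x k") (auto simp: I_def tsigned_iff)
  let ?c = "\<lambda>q. card (case_prod U q)"
  have fin: "finite (?c ` I)" using \<open>finite I\<close> by simp
  with \<open>I \<noteq> {}\<close> have "Max (?c ` I) \<in> ?c ` I" by (intro Max_in) auto
  then obtain p where p: "p \<in> I" "?c p = Max (?c ` I)" by auto
  obtain i a where ia: "(i, a) \<in> I" and max: "\<And>q. q \<in> I \<Longrightarrow> card (case_prod U q) \<le> card (U i a)"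
    using p Max_ge[OF fin] by (cases p) (fastforce simp: p(2)[symmetric])
  then have i: "i \<in> A" "x i = TPos a" by (auto simp: I_def)
  obtain j b where j: "j \<in> A" "x j = TNeg b" "\<not> R i a j b" using np'[OF i] by blast
  obtain i' a' where i': "i' \<in> A" "x i' = TPos a'" "R i' a' j b" using nn[OF j(1,2)] by blast
  have "U i a \<subseteq> U i' a'"
  proof
    fix w assume "w \<in> U i a"
    then obtain c where w: "w \<in> A" "x w = TNeg c" "R i a w c" by (auto simp: U_def)
    have "w \<noteq> j" using w j by auto
    have ne: "i \<noteq> j" "i \<noteq> w" "i' \<noteq> j" "i' \<noteq> w" using i i' w j by auto
    have "R j b w c"  if "\<not> R i' a' w c" using that ne i' w j \<open>w \<noteq> j\<close> i trans cotrans by metis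
    with w j have "R i' a' w c" using ne trans[of i' j w a' b c] i' \<open>w \<noteq> j\<close> i by blast
    with w show "w \<in> U i' a'" by (auto simp: U_def)
  qed
  moreover have "j \<in> U i' a'" "j \<notin> U i a" using i' j by (auto simp: U_def)
  ultimately have "card (U i a) < card (U i' a')" by (intro psubset_card_mono) auto
  with max[of "(i', a')"] i' show False by (auto simp: I_def)
qed

subsection \<open>Orders whose ties occur at equal norms\<close>

locale aligned_dominance = dominance +
  assumes aligned: "\<lbrakk>i \<in> A; j \<in> A; i \<noteq> j; R i a j b; R j b i a\<rbrakk> \<Longrightarrow> a = b"
begin

text \<open>\<open>shift\<close> reduces ties at equal norms to norm 0 and \<open>aligned\<close>
  excludes all others, so these are the coordinates with monomials that outweigh each other both
  ways.\<close>

definition tied :: "'a \<Rightarrow> 'a set" where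
  "tied i = {j \<in> A. j = i \<or> R i 0 j 0 \<and> R j 0 i 0}"

definition tied_sum :: "'a \<Rightarrow> ('a \<Rightarrow> puiseux) \<Rightarrow> puiseux" where
  "tied_sum i z = sum z (tied i)"

text \<open>Dominance is imposed on class sums instead of entries: ties are settled by cancellation
  in the field, which makes the set closed under addition.\<close>

definition lift :: "('a \<Rightarrow> puiseux) set" where
  "lift = {z. \<exists>i\<in>A. 0 < tied_sum i z \<and> (\<forall>j\<in>A. tied_sum j z < 0 \<longrightarrow>
     R i (lead_exp (tied_sum i z)) j (lead_exp (tied_sum j z)))}"

lemma tied_D:
  assumes "i \<in> A" "j \<in> tied i" "j \<noteq> i"
  shows "j \<in> A" "R i a j a" "R j a i a"
  using assms shift[of i j 0 0 a] shift[of j i 0 0 a] by (auto simp: tied_def)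

lemma tied_sym: "i \<in> A \<Longrightarrow> j \<in> tied i \<Longrightarrow> i \<in> tied j"
  by (auto simp: tied_def)

lemma tied_trans:
  assumes i: "i \<in> A" and j: "j \<in> tied i" and k: "k \<in> tied j"
  shows "k \<in> tied i"
proof (cases "j = i \<or> k = j \<or> k = i")
  case True
  with assms show ?thesis by (auto simp: tied_def)
next
  case False
  then have ne: "i \<noteq> j" "j \<noteq> k" "i \<noteq> k" "k \<noteq> j" "j \<noteq> i" "k \<noteq> i" by auto
  have jA: "j \<in> A" and kA: "k \<in> A" using j k by (auto simp: tied_def)
  have "R i 0 j 0" "R j 0 i 0" "R j 0 k 0" "R k 0 j 0"
    using j k ne by (auto simp: tied_def)
  then have "R i 0 k 0" "R k 0 i 0"
    using trans[OF i jA kA ne(1-3)] trans[OF kA jA i ne(4-6)] by blast+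
  with kA show ?thesis by (simp add: tied_def)
qed

lemma tied_eq:
  assumes "i \<in> A" "j \<in> tied i"
  shows "tied j = tied i"
proof
  have "j \<in> A" using assms by (auto simp: tied_def)
  then show "tied j \<subseteq> tied i" "tied i \<subseteq> tied j"
    using tied_trans tied_sym assms by blast+
qed

lemma tied_sum_eq: "i \<in> A \<Longrightarrow> j \<in> tied i \<Longrightarrow> tied_sum j z = tied_sum i z"
  by (simp add: tied_sum_def tied_eq)

lemma tiedI:
  assumes "i \<in> A" "j \<in> A" "i \<noteq> j" "R i a j b" "R j b i a"
  shows "j \<in> tied i"
  using aligned[OF assms] shift[of i j a b "- a"] shift[of j i b a "- a"] assms
  by (auto simp: tied_def)

lemma tied_self: "i \<in> A \<Longrightarrow> i \<in> tied i"
  by (simp add: tied_def)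

lemma tied_sum_add: "tied_sum i (\<lambda>k. z k + w k) = tied_sum i z + tied_sum i w"
  by (simp add: tied_sum_def sum.distrib)

lemma tied_sum_scale: "tied_sum i (\<lambda>k. c * z k) = c * tied_sum i z"
  by (simp add: tied_sum_def sum_distrib_left)

lemma lift_scale:
  assumes "z \<in> lift" "0 < c"
  shows "(\<lambda>k. c * z k) \<in> lift"
proof -
  obtain i where i: "i \<in> A" "0 < tied_sum i z"
    and R: "\<And>j. j \<in> A \<Longrightarrow> tied_sum j z < 0 \<Longrightarrow> R i (lead_exp (tied_sum i z)) j (lead_exp (tied_sum j z))"
    using assms unfolding lift_def by blast
  have "R i (lead_exp (c * tied_sum i z)) j (lead_exp (c * tied_sum j z))"
    if "j \<in> A" "c * tied_sum j z < 0" for j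
  proof -
    have "tied_sum j z < 0" using that assms(2) by (simp add: mult_less_0_iff)
    moreover from this i have "j \<noteq> i" by auto
    ultimately show ?thesis
      using shift[OF i(1) \<open>j \<in> A\<close> _ R, of "lead_exp c"] that(1) i assms(2)
      by (simp add: lead_exp_mult add.commute)
  qed
  with i assms(2) show ?thesis
    by (auto simp: lift_def tied_sum_scale intro!: bexI[of _ i] mult_pos_pos)
qed

text \<open>A negative class sum of \<open>z + w\<close> is bounded in norm by a negative class sum
  of \<open>z\<close> or of \<open>w\<close>, both outweighed by the class of \<open>i\<close>,
  whose own norm does not drop.\<close>

lemma lift_add_aux:
  assumes i: "i \<in> A" "0 < tied_sum i z"
    and R: "\<And>j. j \<in> A \<Longrightarrow> tied_sum j z < 0 \<Longrightarrow> R i (lead_exp (tied_sum i z)) j (lead_exp (tied_sum j z))"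
    and R': "\<And>j. j \<in> A \<Longrightarrow> j \<noteq> i \<Longrightarrow> tied_sum j w < 0 \<Longrightarrow> R i (lead_exp (tied_sum i z)) j (lead_exp (tied_sum j w))"
    and self: "tied_sum i w < 0 \<Longrightarrow> lead_exp (tied_sum i w) < lead_exp (tied_sum i z)"
  shows "(\<lambda>k. z k + w k) \<in> lift"
proof -
  define s t where "s = tied_sum i z" and "t = tied_sum i w"
  have "0 < s + t \<and> lead_exp s \<le> lead_exp (s + t)"
  proof (cases "t < 0")
    case True
    \<comment> \<open>The factor 2 rules out a drop by cancellation: it yields
      \<open>s <= 2 * (s + t)\<close>.\<close>
    have two: "of_nat 2 * (- t) < s"
      by (rule of_nat_mult_less_of_lead_exp_less) (use True self i in \<open>auto simp: s_def t_def\<close>)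
    have "s \<le> of_nat 2 * (s + t)" using two by (simp add: algebra_simps)
    moreover have "0 < s + t" using two True by (simp add: algebra_simps)
    ultimately show ?thesis
      using lead_exp_le_of_le_of_nat_mult[of s "s + t" 2] i by (simp add: s_def)
  next
    case False
    then show ?thesis using i lead_exp_mono[of s "s + t"] by (auto simp: s_def)
  qed
  then have pos: "0 < s + t" and le: "lead_exp s \<le> lead_exp (s + t)" by auto
  have "R i (lead_exp (s + t)) j (lead_exp (tied_sum j z + tied_sum j w))"
    if j: "j \<in> A" "tied_sum j z + tied_sum j w < 0" for j
  proof -
    have ne: "i \<noteq> j" using pos j by (auto simp: s_def t_def)
    obtain b where b: "R i (lead_exp s) j b" "lead_exp (tied_sum j z + tied_sum j w) \<le> b"
      using add_neg_dominating_term[OF j(2)] R[OF j(1)] R'[OF j(1)] ne unfolding s_def by blast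
    then show ?thesis using mono[OF i(1) j(1) ne _ le] by blast
  qed
  then show ?thesis
    using i pos by (auto simp: lift_def tied_sum_add s_def t_def)
qed

text \<open>For \<open>i = i'\<close> the larger exponent decides. Otherwise, if the class of
  \<open>i'\<close> outweighs that of \<open>i\<close>, it dominates the sum by
  \<open>trans\<close>; if not, the class of \<open>i\<close> does by
  \<open>cotrans\<close>.\<close>

lemma lift_add:
  assumes "z \<in> lift" "w \<in> lift"
  shows "(\<lambda>k. z k + w k) \<in> lift"
proof -
  obtain i where i: "i \<in> A" "0 < tied_sum i z"
    and R: "\<And>j. j \<in> A \<Longrightarrow> tied_sum j z < 0 \<Longrightarrow> R i (lead_exp (tied_sum i z)) j (lead_exp (tied_sum j z))"
    using assms unfolding lift_def by blast
  obtain i' where i': "i' \<in> A" "0 < tied_sum i' w"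
    and R': "\<And>j. j \<in> A \<Longrightarrow> tied_sum j w < 0 \<Longrightarrow> R i' (lead_exp (tied_sum i' w)) j (lead_exp (tied_sum j w))"
    using assms unfolding lift_def by blast
  define a a' where "a = lead_exp (tied_sum i z)" and "a' = lead_exp (tied_sum i' w)"
  have comm: "(\<lambda>k. z k + w k) = (\<lambda>k. w k + z k)" by (simp add: add.commute)
  show ?thesis
  proof (cases "i = i'")
    case True
    show ?thesis
    proof (cases "a' \<le> a")
      case le: True
      show ?thesis
        by (rule lift_add_aux[OF i R])
          (use True i' R' mono[OF i(1), of _ a' _ a] le in \<open>auto simp: a_def a'_def\<close>)
    next
      case le: False
      show ?thesis unfolding comm
        by (rule lift_add_aux[OF i' R'])
          (use True i R mono[OF i(1), of _ a _ a'] le in \<open>auto simp: a_def a'_def\<close>)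
    qed
  next
    case ne: False
    show ?thesis
    proof (cases "R i' a' i a")
      case False
      show ?thesis
      proof (rule lift_add_aux[OF i R])
        fix j assume j: "j \<in> A" "j \<noteq> i" "tied_sum j w < 0"
        then have "j \<noteq> i'" using i' by auto
        show "R i (lead_exp (tied_sum i z)) j (lead_exp (tied_sum j w))"
        proof (rule ccontr)
          assume "\<not> ?thesis"
          then have "R i' a' i a"
            using cotrans[OF i'(1) i(1) j(1) _ _ _ R'[OF j(1,3)], of a] ne j \<open>j \<noteq> i'\<close>
            by (auto simp: a_def a'_def)
          with False show False ..
        qed
      next
        assume "tied_sum i w < 0"
        from R'[OF i(1) this] show "lead_exp (tied_sum i w) < lead_exp (tied_sum i z)"
          using mono[OF i'(1) i(1), of a' "lead_exp (tied_sum i w)" a' a] False ne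
          by (fastforce simp: a_def a'_def)
      qed auto
    next
      case True
      show ?thesis unfolding comm
      proof (rule lift_add_aux[OF i' R'])
        fix j assume j: "j \<in> A" "j \<noteq> i'" "tied_sum j z < 0"
        then have "j \<noteq> i" using i by auto
        with trans[OF i'(1) i(1) j(1) _ _ _ True] R[OF j(1,3)] ne j
        show "R i' (lead_exp (tied_sum i' w)) j (lead_exp (tied_sum j z))"
          by (auto simp: a_def a'_def)
      next
        assume neg: "tied_sum i' z < 0"
        show "lead_exp (tied_sum i' z) < lead_exp (tied_sum i' w)"
        \<comment> \<open>Otherwise \<open>i\<close> and \<open>i'\<close> outweigh each other,
          hence lie in one class, whose sum in \<open>z\<close> would be both positive and
          negative.\<close>
        proof (rule ccontr)
          assume "\<not> ?thesis"
          with mono[OF i(1) i'(1) ne R[OF i'(1) neg], of a a'] have "R i a i' a'"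
            by (auto simp: a_def a'_def)
          with True have "i' \<in> tied i" using tiedI[OF i(1) i'(1) ne] by blast
          with tied_sum_eq[OF i(1)] neg i show False by auto
        qed
      qed auto
    qed
  qed
qed

text \<open>By \<open>dominated_cases\<close> it remains to exclude a negative entry
  \<open>j\<close> that no positive entry outweighs. Such an entry is not cancelled in its class,
  since a tied positive entry of at least its norm would outweigh it. So its class sum is negative,
  of at least its norm, and outweighed by the class of \<open>i\<close>, hence by the positive entry
  \<open>l\<close> of that class.\<close>

lemma sval_lift:
  assumes "z \<in> lift"
  shows "(\<lambda>k. sval (z k)) \<in> dominated A R"
proof -
  obtain i where i: "i \<in> A" "0 < tied_sum i z"
    and R: "\<And>j. j \<in> A \<Longrightarrow> tied_sum j z < 0 \<Longrightarrow> R i (lead_exp (tied_sum i z)) j (lead_exp (tied_sum j z))"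
    using assms unfolding lift_def by blast
  define a where "a = lead_exp (tied_sum i z)"
  obtain l where l: "l \<in> tied i" "0 < z l" "a \<le> lead_exp (z l)"
    using sum_pos_dominating_term[of "tied i" z] i by (auto simp: tied_sum_def a_def)
  have lA: "l \<in> A" using l by (simp add: tied_def)
  have "\<not> (\<forall>k\<in>A. sval (z k) = TZero)"
    using lA l by (auto simp: sval_eq_simps intro!: bexI[of _ l])
  moreover have False if j: "j \<in> A" "sval (z j) = TNeg b"
    and no: "\<And>i a. i \<in> A \<Longrightarrow> sval (z i) = TPos a \<Longrightarrow> \<not> R i a j b" for j b
  proof -
    have zj: "z j < 0" "lead_exp (z j) = b" using j by (simp_all add: sval_eq_simps)
    have "lead_exp (z m) < lead_exp (z j)" if m: "m \<in> tied j" "0 < z m" for m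
    proof (rule ccontr)
      assume n: "\<not> ?thesis"
      have "m \<noteq> j" using zj m by auto
      with tied_D(1)[OF j(1) m(1)] tied_D(3)[OF j(1) m(1), of b] mono[of m j b b "lead_exp (z m)" b] n zj j
      have "m \<in> A" "R m (lead_exp (z m)) j b" by auto
      with no[of m "lead_exp (z m)"] m show False by (simp add: sval_eq_simps)
    qed
    then have sum: "tied_sum j z < 0" "lead_exp (z j) \<le> lead_exp (tied_sum j z)"
      using sum_neg_of_dominating_term[of "tied j" j z] tied_self[OF j(1)] zj(1)
      by (auto simp: tied_sum_def)
    have "j \<noteq> i" "j \<notin> tied i" using sum i tied_sum_eq[OF i(1), of j z] by auto
    have "R i a j b"
      using mono[OF i(1) j(1) _ R[OF j(1) sum(1)], of a b] \<open>j \<noteq> i\<close> sum(2) zj by (auto simp: a_def)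
    have "R l a j b"
    proof (cases "l = i")
      case False
      have "l \<noteq> j" using l \<open>j \<notin> tied i\<close> by auto
      with trans[OF lA i(1) j(1) False _ _ tied_D(3)[OF i(1) l(1) False] \<open>R i a j b\<close>] \<open>j \<noteq> i\<close>
      show ?thesis by auto
    qed (use \<open>R i a j b\<close> in simp)
    moreover have "l \<noteq> j" using l zj by auto
    ultimately have "R l (lead_exp (z l)) j b"
      using mono[OF lA j(1), of a b "lead_exp (z l)" b] l zj by auto
    with no[OF lA, of "lead_exp (z l)"] l show False by (simp add: sval_eq_simps)
  qed
  ultimately show ?thesis
    using dominated_cases[of "\<lambda>k. sval (z k)"] sval_signed by blast
qed

text \<open>Entries are lifted to signed monomials, except that the dominating one gets an integer
  coefficient too large to be cancelled within its class.\<close>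

lemma dominated_lift:
  assumes "x \<in> dominated A R"
  obtains z where "z \<in> lift" "(\<lambda>k. sval (z k)) = x"
proof -
  obtain i a where i: "i \<in> A" "x i = TPos a"
    and R: "\<And>j b. j \<in> A \<Longrightarrow> x j = TNeg b \<Longrightarrow> R i a j b" and x: "\<And>k. x k \<in> tsigned"
    using assms unfolding dominated_def by blast
  \<comment> \<open>At most \<open>n - 1\<close> other entries share the class of \<open>i\<close>,
    each at least \<open>- pmonom a\<close>; a coefficient \<open>n\<close> leaves at least
    \<open>pmonom a\<close>.\<close>
  define n where "n = Suc (card (UNIV :: 'a set))"
  define m where "m k = (case x k of TZero \<Rightarrow> 0 | TPos r \<Rightarrow> pmonom r | TNeg r \<Rightarrow> - pmonom r | TBal r \<Rightarrow> 0)" for k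
  define z where "z = m(i := of_nat n * pmonom a)"
  have le_n: "lead_exp (of_nat n * pmonom a) = a" and pos_n: "0 < of_nat n * pmonom a"
  proof -
    show pos: "0 < of_nat n * pmonom a" by (intro mult_pos_pos) (auto simp: n_def simp del: of_nat_Suc)
    have "pmonom a \<le> of_nat n * pmonom a"
      using mult_right_mono[of 1 "of_nat n" "pmonom a"] by (simp add: n_def less_imp_le)
    with lead_exp_mono[of "pmonom a"] lead_exp_le_of_le_of_nat_mult[OF pos pmonom_pos order_refl]
    show "lead_exp (of_nat n * pmonom a) = a" by fastforce
  qed
  have sval_m: "sval (m k) = x k" for k
    using x[of k] by (cases "x k") (auto simp: m_def sval_eq_simps tsigned_iff)
  have sval_z: "sval (z k) = x k" for k
    using sval_m[of k] i le_n pos_n by (auto simp: z_def sval_eq_simps)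
  have zneg: "x k = TNeg (lead_exp (z k))" if "z k < 0" for k
    using sval_z[of k] that by (simp add: sval_eq_simps flip: sval_z)
  have top: "pmonom a \<le> tied_sum i z"
  proof -
    have "- pmonom a \<le> z k" if k: "k \<in> tied i - {i}" for k
    proof (cases "z k < 0")
      case True
      have "m k = - pmonom (lead_exp (z k))" unfolding m_def zneg[OF True] by simp
      then have "z k = - pmonom (lead_exp (z k))" using k by (simp add: z_def)
      moreover have "R i a k (lead_exp (z k))" using R[OF _ zneg[OF True]] k by (simp add: tied_def)
      \<comment> \<open>Being tied, \<open>k\<close> outweighs \<open>i\<close> at the common norm
        \<open>lead_exp (z k)\<close>; with \<open>R i a k (lead_exp (z k))\<close>,
        \<open>cycle\<close> compares the norms.\<close>
      then have "lead_exp (z k) \<le> a"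
        using cycle[OF i(1), of k a "lead_exp (z k)" "lead_exp (z k)"] tied_D[OF i(1), of k] k by auto
      then have "pmonom (lead_exp (z k)) \<le> pmonom a" by (rule pmonom_mono)
      ultimately show ?thesis by simp
    next
      case False
      then show ?thesis using pmonom_pos[of a] by (meson neg_le_0_iff_le not_le order.trans less_imp_le)
    qed
    then have "of_nat (card (tied i - {i})) * (- pmonom a) \<le> sum z (tied i - {i})"
      by (rule sum_bounded_below)
    moreover have "card (tied i - {i}) \<le> card (UNIV :: 'a set)" by (rule card_mono) auto
    then have "of_nat (card (tied i - {i})) * pmonom a \<le> of_nat (card (UNIV :: 'a set)) * pmonom a"
      by (intro mult_right_mono) (auto intro: less_imp_le)
    moreover have "tied_sum i z = of_nat n * pmonom a + sum z (tied i - {i})"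
      unfolding tied_sum_def using sum.remove[of "tied i" i z] i by (simp add: z_def tied_def)
    ultimately show ?thesis
      unfolding n_def of_nat_Suc distrib_right mult_1_left mult_minus_right by linarith
  qed
  have "z \<in> lift"
    unfolding lift_def
  proof (intro CollectI bexI[OF _ i(1)] conjI ballI impI)
    show pos: "0 < tied_sum i z" using top pmonom_pos[of a] by (rule less_le_trans[rotated])
    have a: "a \<le> lead_exp (tied_sum i z)" using lead_exp_mono[OF pmonom_pos top] by simp
    fix j assume j: "j \<in> A" "tied_sum j z < 0"
    then have ij: "i \<noteq> j" "i \<notin> tied j" using pos tied_sum_eq[OF j(1), of i z] by auto
    have "0 < (\<Sum>k\<in>tied j. - z k)" using j by (simp add: tied_sum_def sum_negf)
    from sum_pos_dominating_term[OF _ this]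
    obtain l where l: "l \<in> tied j" "z l < 0" "lead_exp (tied_sum j z) \<le> lead_exp (z l)"
      by (auto simp: tied_sum_def sum_negf)
    have lA: "l \<in> A" and "l \<noteq> i" using l ij by (auto simp: tied_def)
    have Rl: "R i a l (lead_exp (z l))" by (rule R[OF lA zneg[OF l(2)]])
    have "R i a j (lead_exp (z l))"
    proof (cases "l = j")
      case False
      with trans[OF i(1) lA j(1) _ _ ij(1) Rl tied_D(3)[OF j(1) l(1)]] \<open>l \<noteq> i\<close> show ?thesis by auto
    qed (use Rl in simp)
    then show "R i (lead_exp (tied_sum i z)) j (lead_exp (tied_sum j z))"
      using mono[OF i(1) j(1) ij(1) _ a l(3)] by blast
  qed
  then show thesis using sval_z by (intro that) auto
qed

lemma lift_cong: "z \<in> lift \<Longrightarrow> (\<And>k. k \<in> A \<Longrightarrow> w k = z k) \<Longrightarrow> w \<in> lift"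
proof -
  assume z: "z \<in> lift" and "\<And>k. k \<in> A \<Longrightarrow> w k = z k"
  then have "tied_sum i w = tied_sum i z" for i
    unfolding tied_sum_def by (intro sum.cong) (auto simp: tied_def)
  with z show "w \<in> lift" by (simp add: lift_def)
qed

end

subsection \<open>Arbitrary dominance orders\<close>

definition puiseux_cone :: "('i \<Rightarrow> puiseux) set \<Rightarrow> bool" where
  "puiseux_cone C \<longleftrightarrow> (\<forall>z\<in>C. \<forall>w\<in>C. (\<lambda>k. z k + w k) \<in> C) \<and> (\<forall>z\<in>C. \<forall>c>0. (\<lambda>k. c * z k) \<in> C)"

context dominance
begin

text \<open>Completed on the diagonal, where \<open>R\<close> carries no axioms, to an equivalence
  relation on the monomials over \<open>A\<close>.\<close>

definition tie :: "'i \<Rightarrow> real \<Rightarrow> 'i \<Rightarrow> real \<Rightarrow> bool" where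
  "tie i a j b \<longleftrightarrow> (if i = j then a = b else R i a j b \<and> R j b i a)"

lemma tie_sym: "tie i a j b \<Longrightarrow> tie j b i a"
  by (auto simp: tie_def split: if_splits)

lemma tie_shift: "i \<in> A \<Longrightarrow> j \<in> A \<Longrightarrow> tie i a j b \<Longrightarrow> tie i (a + c) j (b + c)"
  using shift[of i j a b c] shift[of j i b a c] by (auto simp: tie_def split: if_splits)

lemma tie_trans:
  assumes A: "i \<in> A" "j \<in> A" "k \<in> A" and ij: "tie i a j b" and jk: "tie j b k c"
  shows "tie i a k c"
proof -
  consider "i = j" | "j = k" | "i = k" "i \<noteq> j" | "i \<noteq> j" "j \<noteq> k" "i \<noteq> k" by blast
  then show ?thesis
  proof cases
    case 1
    then have "a = b" using ij by (simp add: tie_def)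
    with 1 jk show ?thesis by simp
  next
    case 2
    then have "b = c" using jk by (simp add: tie_def)
    with 2 ij show ?thesis by simp
  next
    case 3
    then have R: "R i a j b" "R j b i a" "R i c j b" "R j b i c"
      using ij jk by (simp_all add: tie_def)
    have "c \<le> a" by (rule cycle[OF A(1,2) 3(2) R(1,4)])
    moreover have "a \<le> c" by (rule cycle[OF A(1,2) 3(2) R(3,2)])
    ultimately show ?thesis using 3 by (simp add: tie_def)
  next
    case 4
    then have ne: "k \<noteq> j" "j \<noteq> i" "k \<noteq> i" by auto
    have R: "R i a j b" "R j b i a" "R j b k c" "R k c j b"
      using 4 ij jk by (simp_all add: tie_def)
    have "R i a k c" by (rule trans[OF A 4 R(1,3)])
    moreover have "R k c i a" by (rule trans[OF A(3,2,1) ne R(4,2)])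
    ultimately show ?thesis using 4 by (simp add: tie_def)
  qed
qed

text \<open>
  Rescaling the coordinates of each tie class against a common representative moves all ties to
  equal norms.
\<close>

lemma obtain_alignment:
  obtains \<tau> where "aligned_dominance A (\<lambda>i a j b. R i (a - \<tau> i) j (b - \<tau> j))"
proof -
  define T where "T i = {r \<in> A. \<exists>c. tie r c i 0}" for i
  \<comment> \<open>The choice depends on \<open>i\<close> only through \<open>T i\<close>, so
    coordinates with tied monomials share their representative.\<close>
  define r where "r i = (SOME r. r \<in> T i)" for i
  define \<tau> where "\<tau> i = (SOME c. tie (r i) c i 0)" for i
  have r: "r i \<in> A" "tie (r i) (\<tau> i) i 0" if "i \<in> A" for i
  proof -
    have "i \<in> T i" using that by (auto simp: T_def tie_def)
    then have "r i \<in> T i" unfolding r_def by (rule someI)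
    then show "r i \<in> A" "tie (r i) (\<tau> i) i 0"
      unfolding T_def \<tau>_def by (auto intro: someI)
  qed
  have T_mono: "T i \<subseteq> T j" if A: "i \<in> A" "j \<in> A" and t: "tie i a j b" for i j a b
  proof
    fix s assume "s \<in> T i"
    then obtain c where s: "s \<in> A" "tie s c i 0" by (auto simp: T_def)
    have "tie s (c + (a - b)) i (a - b)" using tie_shift[OF s(1) A(1) s(2), of "a - b"] by simp
    moreover have "tie i (a - b) j 0" using tie_shift[OF A t, of "- b"] by simp
    ultimately have "tie s (c + (a - b)) j 0" by (rule tie_trans[OF s(1) A])
    with s show "s \<in> T j" by (auto simp: T_def)
  qed
  have "aligned_dominance A (\<lambda>i a j b. R i (a - \<tau> i) j (b - \<tau> j))"
  proof (unfold_locales, goal_cases)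
    case (1 i j a b a' b')
    then show ?case using mono[of i j "a - \<tau> i" "b - \<tau> j"] by auto
  next
    case (2 i j a b c)
    then show ?case using shift[of i j "a - \<tau> i" "b - \<tau> j" c] by (auto simp: algebra_simps)
  next
    case (3 i j k a b c)
    then show ?case using trans by blast
  next
    case (4 i j k a c b)
    then show ?case using cotrans by blast
  next
    case (5 i j a b a')
    then show ?case using cycle[of i j "a - \<tau> i" "b - \<tau> j" "a' - \<tau> i"] by auto
  next
    case (6 i j a b a')
    then show ?case using cocycle[of i j "a - \<tau> i" "b - \<tau> j" "a' - \<tau> i"] by auto
  next
    case (7 i j a b)
    then have t: "tie i (a - \<tau> i) j (b - \<tau> j)" by (simp add: tie_def)
    have "T i = T j"
      using T_mono[OF 7(1,2) t] T_mono[OF 7(2,1) tie_sym[OF t]] by (rule equalityI)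
    then have eq: "r j = r i" by (simp add: r_def)
    have "tie (r i) a i (a - \<tau> i)"
      using tie_shift[OF r(1) 7(1) r(2), OF 7(1) 7(1), of "a - \<tau> i"] by simp
    from tie_trans[OF r(1)[OF 7(1)] 7(1,2) this t]
    have "tie (r i) a j (b - \<tau> j)" .
    moreover have "tie j (b - \<tau> j) (r i) b"
      using tie_sym[OF tie_shift[OF r(1) 7(2) r(2), OF 7(2) 7(2), of "b - \<tau> j"]] eq by simp
    \<comment> \<open>The common representative is tied to itself at norms \<open>a\<close> and
      \<open>b\<close>, which on the diagonal means equality.\<close>
    ultimately have "tie (r i) a (r i) b"
      by (rule tie_trans[OF r(1)[OF 7(1)] 7(2) r(1)[OF 7(1)]])
    then show ?case by (simp add: tie_def)
  qed
  then show thesis by (rule that)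
qed

text \<open>The alignment is realised by multiplying coordinate \<open>k\<close> by the positive
  monomial \<open>pmonom (\<tau> k)\<close>, which respects cones. The last clause later allows
  vectors vanishing on \<open>A\<close> to be added freely.\<close>

lemma dominated_eq_sval_cone:
  obtains C where "puiseux_cone C" "(\<lambda>z k. sval (z k)) ` C = dominated A R"
    "\<forall>z w. z \<in> C \<longrightarrow> (\<forall>k\<in>A. w k = z k) \<longrightarrow> w \<in> C"
proof -
  obtain \<tau> where al: "aligned_dominance A (\<lambda>i a j b. R i (a - \<tau> i) j (b - \<tau> j))"
    (is "aligned_dominance A ?R") by (rule obtain_alignment)
  interpret al: aligned_dominance A ?R by (rule al)
  define C where "C = {z. (\<lambda>k. pmonom (\<tau> k) * z k) \<in> al.lift}"
  have scaled: "(\<lambda>k. TPos (\<tau> k) * x k) \<in> dominated A ?R \<longleftrightarrow> x \<in> dominated A R" for x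
  proof -
    have "TPos t * y \<in> tsigned \<longleftrightarrow> y \<in> tsigned" for t y
      by (cases y) (auto simp: tsigned_iff)
    moreover have "TPos t * y = TPos a \<longleftrightarrow> y = TPos (a - t)" "TPos t * y = TNeg a \<longleftrightarrow> y = TNeg (a - t)" for t y a
      by (cases y; auto)+
    moreover have ex: "(\<exists>a. P (a - t)) \<longleftrightarrow> (\<exists>a. P a)" for t :: real and P
      by (metis add_diff_cancel_right')
    have "(\<forall>b. x j = TNeg (b - t) \<longrightarrow> P (b - t)) \<longleftrightarrow> (\<forall>b. x j = TNeg b \<longrightarrow> P b)" for j t P
      using ex[of "\<lambda>b. \<not> (x j = TNeg b \<longrightarrow> P b)" t] by blast
    moreover have "(\<exists>a. x i = TPos (a - \<tau> i) \<and> (\<forall>j\<in>A. \<forall>b. x j = TNeg b \<longrightarrow> R i (a - \<tau> i) j b)) \<longleftrightarrow>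
        (\<exists>a. x i = TPos a \<and> (\<forall>j\<in>A. \<forall>b. x j = TNeg b \<longrightarrow> R i a j b))" for i
      by (rule ex[of "\<lambda>a. x i = TPos a \<and> (\<forall>j\<in>A. \<forall>b. x j = TNeg b \<longrightarrow> R i a j b)"])
    ultimately show ?thesis by (simp add: dominated_def)
  qed
  have sval_scaled: "(\<lambda>k. sval (pmonom (\<tau> k) * z k)) = (\<lambda>k. TPos (\<tau> k) * sval (z k))" for z
    by (simp add: sval_mult sval_pmonom)
  show thesis
  proof (rule that)
    have "(\<lambda>k. pmonom (\<tau> k) * (z k + w k)) = (\<lambda>k. pmonom (\<tau> k) * z k + pmonom (\<tau> k) * w k)"
      "(\<lambda>k. pmonom (\<tau> k) * (c * z k)) = (\<lambda>k. c * (pmonom (\<tau> k) * z k))" for z w c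
      by (simp_all add: distrib_left mult.left_commute)
    then show "puiseux_cone C"
      by (simp add: puiseux_cone_def C_def al.lift_add al.lift_scale)
    show "(\<lambda>z k. sval (z k)) ` C = dominated A R"
    proof
      show "(\<lambda>z k. sval (z k)) ` C \<subseteq> dominated A R"
        by (auto simp: C_def sval_scaled scaled dest!: al.sval_lift)
      show "dominated A R \<subseteq> (\<lambda>z k. sval (z k)) ` C"
      proof
        fix x assume "x \<in> dominated A R"
        then have "(\<lambda>k. TPos (\<tau> k) * x k) \<in> dominated A ?R" by (simp only: scaled)
        then obtain z where z: "z \<in> al.lift" "(\<lambda>k. sval (z k)) = (\<lambda>k. TPos (\<tau> k) * x k)"
          by (rule al.dominated_lift)
        have "sval (pmonom (- \<tau> k) * z k) = x k" for k
        proof -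
          have "TPos (- t) * (TPos t * y) = y" for t y by (cases y) auto
          then show ?thesis using fun_cong[OF z(2), of k] by (simp add: sval_mult sval_pmonom)
        qed
        moreover have "(\<lambda>k. pmonom (- \<tau> k) * z k) \<in> C" using z by (simp add: C_def)
        ultimately show "x \<in> (\<lambda>z k. sval (z k)) ` C" by (intro image_eqI) auto
      qed
    qed
    show "\<forall>z w. z \<in> C \<longrightarrow> (\<forall>k\<in>A. w k = z k) \<longrightarrow> w \<in> C"
    proof (intro allI impI)
      fix z w assume "z \<in> C" and eq: "\<forall>k\<in>A. w k = z k"
      then have "(\<lambda>k. pmonom (\<tau> k) * z k) \<in> al.lift" by (simp add: C_def)
      then have "(\<lambda>k. pmonom (\<tau> k) * w k) \<in> al.lift" by (rule al.lift_cong) (simp add: eq)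
      then show "w \<in> C" by (simp add: C_def)
    qed
  qed
qed

end

section \<open>Complementary tropical cones\<close>

lemma TZero_add [simp]: "TZero + x = x" "x + TZero = x"
  using add_0_left[of x] add_0_right[of x] by (simp_all only: zero_symtrop_def)

lemma TZero_mult [simp]: "x * TZero = TZero"
  by (cases x) auto

lemma TZero_signed [simp]: "TZero \<in> tsigned"
  by (simp add: tsigned_iff)

lemma tnorm_eq_MInfty [simp]: "tnorm x = -\<infinity> \<longleftrightarrow> x = TZero"
  by (cases x) auto

definition tsign_unit :: "symtrop \<Rightarrow> bool" where
  "tsign_unit s \<longleftrightarrow> s = TPos 0 \<or> s = TNeg 0"

lemma tsign_unit_simps:
  assumes "tsign_unit s"
  shows "tnorm (s * x) = tnorm x" "s * (s * x) = x" "s * x \<in> tsigned \<longleftrightarrow> x \<in> tsigned"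
    "s * x = TZero \<longleftrightarrow> x = TZero" "TNeg 0 * (s * TPos a) = s * TNeg a"
    "TNeg 0 * (s * TNeg a) = s * TPos a" "TPos c * (s * TPos a) = s * TPos (a + c)"
    "TPos c * (s * TNeg a) = s * TNeg (a + c)"
  using assms by (cases x; auto simp: tsign_unit_def tsigned_iff)+

text \<open>Unlike \<open>+\<close>, this keeps signed vectors signed, as opposite entries of equal
  norm are resolved to that of \<open>x\<close>.\<close>

definition left_sum :: "('i \<Rightarrow> symtrop) \<Rightarrow> ('i \<Rightarrow> symtrop) \<Rightarrow> 'i \<Rightarrow> symtrop" where
  "left_sum x y = (\<lambda>k. if tnorm (y k) \<le> tnorm (x k) then x k else y k)"

text \<open>A relation and not an operation: outside of \<open>k\<close> the tropical sum has to
  stay signed.\<close>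

definition eliminates :: "'i \<Rightarrow> ('i \<Rightarrow> symtrop) \<Rightarrow> ('i \<Rightarrow> symtrop) \<Rightarrow> ('i \<Rightarrow> symtrop) \<Rightarrow> bool" where
  "eliminates k x y z \<longleftrightarrow> y k = TNeg 0 * x k \<and> z k = TZero \<and> (\<forall>j. j \<noteq> k \<longrightarrow> z j = x j + y j) \<and>
     (\<forall>j. z j \<in> tsigned)"

definition tcone :: "'i \<Rightarrow> ('i \<Rightarrow> symtrop) set \<Rightarrow> bool" where
  "tcone h S \<longleftrightarrow> (\<forall>x\<in>S. \<forall>c. (\<lambda>k. TPos c * x k) \<in> S) \<and> (\<forall>x\<in>S. \<forall>y\<in>S. left_sum x y \<in> S) \<and>
     (\<forall>x\<in>S. \<forall>y\<in>S. \<forall>k z. k \<noteq> h \<longrightarrow> eliminates k x y z \<longrightarrow> z \<in> S)"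

definition restrict_to :: "('i \<Rightarrow> symtrop) \<Rightarrow> 'i set \<Rightarrow> 'i \<Rightarrow> symtrop" where
  "restrict_to x J = (\<lambda>k. if k \<in> J then x k else TZero)"

definition single :: "'i \<Rightarrow> symtrop \<Rightarrow> 'i \<Rightarrow> symtrop" where
  "single k v = (\<lambda>j. if j = k then v else TZero)"

lemma tcone_scale:
  assumes "tcone h S" "x \<in> S"
  shows "(\<lambda>k. TPos c * x k) \<in> S"
proof -
  have "\<forall>x\<in>S. \<forall>c. (\<lambda>k. TPos c * x k) \<in> S"
    using assms(1) unfolding tcone_def by (elim conjE)
  with assms(2) show ?thesis by metis
qed

lemma tcone_left_sum:
  assumes "tcone h S" "x \<in> S" "y \<in> S"
  shows "left_sum x y \<in> S"
proof -
  have "\<forall>x\<in>S. \<forall>y\<in>S. left_sum x y \<in> S"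
    using assms(1) unfolding tcone_def by (elim conjE)
  with assms(2,3) show ?thesis by metis
qed

lemma tcone_eliminate:
  assumes "tcone h S" "x \<in> S" "y \<in> S" "k \<noteq> h" "eliminates k x y z"
  shows "z \<in> S"
proof -
  have "\<forall>x\<in>S. \<forall>y\<in>S. \<forall>k z. k \<noteq> h \<longrightarrow> eliminates k x y z \<longrightarrow> z \<in> S"
    using assms(1) unfolding tcone_def by (elim conjE)
  with assms(2-5) show ?thesis by metis
qed

text \<open>Restrictions of one vector agree where they overlap, so left sums glue them. Membership
  thus follows from the pairs through a fixed anchor \<open>i\<close>.\<close>

lemma tcone_pairs:
  fixes x :: "'i::finite \<Rightarrow> symtrop"
  assumes S: "tcone h S" and pairs: "\<And>k. restrict_to x {i, k} \<in> S"
  shows "x \<in> S"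
proof -
  have "restrict_to x (insert i J) \<in> S" if "finite J" for J
    using that
  proof induction
    case empty
    then show ?case using pairs[of i] by simp
  next
    case (insert k J)
    have "left_sum (restrict_to x (insert i J)) (restrict_to x {i, k}) \<in> S"
      using tcone_left_sum[OF S insert.IH pairs] .
    moreover have "left_sum (restrict_to x (insert i J)) (restrict_to x {i, k}) = restrict_to x (insert i (insert k J))"
    proof
      fix l
      show "left_sum (restrict_to x (insert i J)) (restrict_to x {i, k}) l = restrict_to x (insert i (insert k J)) l"
        by (cases "l = i"; cases "l \<in> J"; cases "l = k"; simp add: left_sum_def restrict_to_def)
    qed
    ultimately show ?case by simp
  qed
  from this[of UNIV] show ?thesis by (simp add: restrict_to_def)
qed

section \<open>Dominance order of a pair of complementary cones\<close>

locale cone_pair =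
  fixes h :: "'i::finite" and P N :: "('i \<Rightarrow> symtrop) set"
  assumes disjoint: "P \<inter> N = {}"
    and cover: "P \<union> N = {x. (\<forall>k. x k \<in> tsigned) \<and> x h \<notin> tnegative}"
    and P_tcone: "tcone h P" and N_tcone: "tcone h N"
    and zero: "(\<lambda>_. TZero) \<in> N" and unit: "single h (TPos 0) \<in> N"
begin

text \<open>After this flip the positive half of each active axis other than \<open>h\<close> lies
  in \<open>P\<close>. The flip at \<open>h\<close> reflects that \<open>unit\<close> belongs to
  \<open>N\<close>.\<close>

definition sg :: "'i \<Rightarrow> symtrop" where
  "sg k = (if k = h \<or> single k (TNeg 0) \<in> P then TNeg 0 else TPos 0)"

text \<open>On the remaining axes both halves lie in \<open>N\<close>, and their entries turn out
  not to affect membership.\<close>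

definition active :: "'i set" where
  "active = {k. k = h \<or> single k (TPos 0) \<in> P \<or> single k (TNeg 0) \<in> P}"

definition pair :: "'i \<Rightarrow> real \<Rightarrow> 'i \<Rightarrow> real \<Rightarrow> 'i \<Rightarrow> symtrop" where
  "pair i a j b = (\<lambda>k. if k = i then sg i * TPos a else if k = j then sg j * TNeg b else TZero)"

text \<open>
  Vectors with a negative \<open>h\<close>-coordinate are outside of \<open>P \<union> N\<close>; for \<open>i = h\<close> the
  relation is therefore defined through the opposite vector.
\<close>

definition outweighs :: "'i \<Rightarrow> real \<Rightarrow> 'i \<Rightarrow> real \<Rightarrow> bool" where
  "outweighs i a j b \<longleftrightarrow> (if i = h then pair j b i a \<notin> P else pair i a j b \<in> P)"

lemma sg_unit: "tsign_unit (sg k)"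
  by (simp add: sg_def tsign_unit_def)

lemmas sg_simps = tsign_unit_simps[OF sg_unit]

lemma h_active: "h \<in> active"
  by (simp add: active_def)

lemma sg_h: "sg h = TNeg 0"
  by (simp add: sg_def)

lemma N_iff: "(\<And>k. x k \<in> tsigned) \<Longrightarrow> x h \<notin> tnegative \<Longrightarrow> x \<in> N \<longleftrightarrow> x \<notin> P"
proof -
  assume "\<And>k. x k \<in> tsigned" "x h \<notin> tnegative"
  then have "x \<in> P \<union> N" unfolding cover by simp
  with disjoint show "x \<in> N \<longleftrightarrow> x \<notin> P" by blast
qed

lemma single_scale:
  assumes "tcone h S" "single k v \<in> S"
  shows "single k (TPos c * v) \<in> S"
proof -
  have "(\<lambda>j. TPos c * single k v j) = single k (TPos c * v)" by (auto simp: single_def)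
  with tcone_scale[OF assms, of c] show ?thesis by simp
qed

lemma single_pos:
  assumes "i \<in> active" "i \<noteq> h"
  shows "single i (sg i * TPos a) \<in> P"
proof -
  have "single i (sg i * TPos 0) \<in> P"
    using assms by (auto simp: active_def sg_def)
  from single_scale[OF P_tcone this, of a] show ?thesis by (simp add: sg_simps)
qed

text \<open>Were both halves of the axis in \<open>P\<close>, eliminating the coordinate would put
  the zero vector into \<open>P\<close>.\<close>

lemma single_neg:
  assumes "i \<in> active"
  shows "single i (sg i * TNeg a) \<in> N"
proof (cases "i = h")
  case True
  with single_scale[OF N_tcone unit, of a] show ?thesis by (simp add: sg_h)
next
  case False
  have "single i (sg i * TNeg a) \<notin> P"
  proof
    assume "single i (sg i * TNeg a) \<in> P"
    moreover have "eliminates i (single i (sg i * TPos a)) (single i (sg i * TNeg a)) (\<lambda>_. TZero)"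
      by (simp add: eliminates_def single_def sg_simps)
    ultimately have "(\<lambda>_. TZero) \<in> P"
      using tcone_eliminate[OF P_tcone single_pos[OF assms False]] False by blast
    with zero disjoint show False by blast
  qed
  then show ?thesis
    by (subst N_iff) (use False in \<open>auto simp: single_def sg_simps tsigned_iff[of "TNeg _"] tnegative_iff\<close>)
qed

lemma single_inactive:
  assumes "k \<notin> active" "v \<in> tsigned"
  shows "single k v \<in> N"
proof -
  have N: "single k (TPos 0) \<in> N" "single k (TNeg 0) \<in> N"
    using assms(1) by (subst N_iff; auto simp: active_def single_def tsigned_iff tnegative_iff)+
  show ?thesis
  proof (cases v)
    case TZero
    then show ?thesis using zero by (simp add: single_def)
  next
    case (TPos a)
    then show ?thesis using single_scale[OF N_tcone N(1), of a] by simp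
  next
    case (TNeg a)
    then show ?thesis using single_scale[OF N_tcone N(2), of a] by simp
  qed (use assms in \<open>simp add: tsigned_iff\<close>)
qed

lemma pair_N_iff: "i \<noteq> h \<Longrightarrow> pair i a j b \<in> N \<longleftrightarrow> pair i a j b \<notin> P"
  using sg_h by (intro N_iff) (auto simp: pair_def sg_simps tsigned_iff[of "TNeg _"] tsigned_iff[of "TPos _"] tnegative_iff)

lemma pair_shift:
  assumes "tcone h S" "pair i a j b \<in> S"
  shows "pair i (a + c) j (b + c) \<in> S"
proof -
  have "(\<lambda>k. TPos c * pair i a j b k) = pair i (a + c) j (b + c)"
    by (auto simp: pair_def sg_simps)
  with tcone_scale[OF assms, of c] show ?thesis by simp
qed

text \<open>Raising \<open>a\<close> is a left sum with a half-axis in \<open>P\<close>. For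
  lowering \<open>b\<close>, a pair in \<open>N\<close> would stay in \<open>N\<close> after a left
  sum with the half-axis of \<open>j\<close>, which restores \<open>b\<close>.\<close>

lemma pair_mono:
  assumes i: "i \<in> active" "i \<noteq> h" and j: "j \<in> active" "i \<noteq> j"
    and P: "pair i a j b \<in> P" and le: "a \<le> a'" "b' \<le> b"
  shows "pair i a' j b' \<in> P"
proof (rule ccontr)
  have "left_sum (single i (sg i * TPos a')) (pair i a j b) = pair i a' j b"
    using j le by (auto simp: left_sum_def single_def pair_def sg_simps)
  with tcone_left_sum[OF P_tcone single_pos[OF i] P, of a'] have "pair i a' j b \<in> P" by simp
  moreover assume "pair i a' j b' \<notin> P"
  then have "pair i a' j b' \<in> N" using i by (simp add: pair_N_iff)
  moreover have "left_sum (single j (sg j * TNeg b)) (pair i a' j b') = pair i a' j b"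
    using j le by (auto simp: left_sum_def single_def pair_def sg_simps)
  ultimately show False
    using tcone_left_sum[OF N_tcone single_neg[OF j(1)], of "pair i a' j b'" b] disjoint by auto
qed

lemma pair_trans:
  assumes S: "tcone h S" and "j \<noteq> h" "i \<noteq> j" "j \<noteq> k" "i \<noteq> k"
    and "pair i a j b \<in> S" "pair j b k c \<in> S"
  shows "pair i a k c \<in> S"
proof -
  have "eliminates j (pair i a j b) (pair j b k c) (pair i a k c)"
    using assms(2-5)
    by (auto simp: eliminates_def pair_def sg_simps tsigned_iff[of "TNeg _"] tsigned_iff[of "TPos _"])
  from tcone_eliminate[OF S assms(6,7,2) this] show ?thesis .
qed

text \<open>Cancelling coordinate \<open>j\<close> leaves on axis \<open>i\<close> the larger of two
  opposite entries.\<close>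

lemma pair_cycle:
  assumes S: "tcone h S" and "j \<noteq> h" "i \<noteq> j"
    and "pair i a j b \<in> S" "pair j b i a' \<in> S"
  shows "a < a' \<Longrightarrow> single i (sg i * TNeg a') \<in> S" "a' < a \<Longrightarrow> single i (sg i * TPos a) \<in> S"
proof -
  have "eliminates j (pair i a j b) (pair j b i a') (single i (sg i * TNeg a'))" if "a < a'"
    using assms(2,3) that
    by (auto simp: eliminates_def pair_def single_def sg_simps tsigned_iff[of "TNeg _"]
        plus_symtrop_def)
  then show "single i (sg i * TNeg a') \<in> S" if "a < a'"
    using tcone_eliminate[OF S assms(4,5,2)] that by blast
  have "eliminates j (pair i a j b) (pair j b i a') (single i (sg i * TPos a))" if "a' < a"
    using assms(2,3) that
    by (auto simp: eliminates_def pair_def single_def sg_simps tsigned_iff[of "TPos _"]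
        plus_symtrop_def)
  then show "single i (sg i * TPos a) \<in> S" if "a' < a"
    using tcone_eliminate[OF S assms(4,5,2)] that by blast
qed

lemma not_P_single_neg: "i \<in> active \<Longrightarrow> single i (sg i * TNeg a) \<notin> P"
  using single_neg disjoint by blast

lemma not_N_single_pos: "i \<in> active \<Longrightarrow> i \<noteq> h \<Longrightarrow> single i (sg i * TPos a) \<notin> N"
  using single_pos disjoint by blast

text \<open>Away from \<open>h\<close>, elimination in \<open>P\<close> gives \<open>trans\<close>,
  elimination in \<open>N\<close> gives \<open>cotrans\<close>, and a violated \<open>cycle\<close>
  or \<open>cocycle\<close> would put a half-axis into the wrong cone. If \<open>h\<close> occurs,
  the reflected definition rearranges the pairs so that \<open>h\<close> is never eliminated, and
  the cyclic laws reduce to \<open>pair_mono\<close>.\<close>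

lemma dominance_outweighs: "dominance active outweighs"
proof (unfold_locales, goal_cases)
  case (1 i j a b a' b')
  then show ?case
    using pair_mono[of i j a b a' b'] pair_mono[of j i b' a' b a] by (auto simp: outweighs_def split: if_splits)
next
  case (2 i j a b c)
  then show ?case
    using pair_shift[OF P_tcone, of i a j b c] pair_shift[OF P_tcone, of j "b + c" i "a + c" "- c"]
    by (auto simp: outweighs_def)
next
  case (3 i j k a b c)
  consider "i = h" | "j = h" | "i \<noteq> h" "j \<noteq> h" by blast
  then show ?case
  proof cases
    case 1
    with 3 show ?thesis using pair_trans[OF P_tcone, of k j i b c a] by (auto simp: outweighs_def)
  next
    case 2
    with 3 show ?thesis
      using pair_trans[OF N_tcone, of k i j a c b] pair_N_iff disjoint by (auto simp: outweighs_def)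
  next
    case hh: 3
    with 3 show ?thesis using pair_trans[OF P_tcone, of j i k a b c] by (auto simp: outweighs_def)
  qed
next
  case (4 i j k a c b)
  consider "i = h" | "j = h" | "i \<noteq> h" "j \<noteq> h" by blast
  then show ?case
  proof cases
    case 1
    with 4 show ?thesis
      using pair_trans[OF N_tcone, of k j i b c a] pair_N_iff disjoint by (auto simp: outweighs_def)
  next
    case 2
    with 4 show ?thesis using pair_trans[OF P_tcone, of k i j a c b] by (auto simp: outweighs_def)
  next
    case 3
    with 4 show ?thesis
      using pair_trans[OF N_tcone, of j i k a b c] pair_N_iff disjoint by (auto simp: outweighs_def)
  qed
next
  case (5 i j a b a')
  show ?case
  proof (rule ccontr)
    assume "\<not> a' \<le> a"
    then have "a < a'" by simp
    with 5 show False
      using pair_cycle(1)[OF P_tcone, of j i a b a'] not_P_single_neg[of i a']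
        pair_mono[of i j a b a' b] pair_mono[of j i b a' b a]
      by (auto simp: outweighs_def split: if_splits)
  qed
next
  case (6 i j a b a')
  show ?case
  proof (rule ccontr)
    assume "\<not> a \<le> a'"
    then have "a' < a" by simp
    with 6 show False
      using pair_cycle(2)[OF N_tcone, of j i a b a'] not_N_single_pos[of i a] pair_N_iff
        pair_mono[of i j a' b a b] pair_mono[of j i b a b a']
      by (auto simp: outweighs_def split: if_splits)
  qed
qed

section \<open>Membership in the cones in terms of the dominance order\<close>

lemma restrict_pair_singles:
  assumes S: "tcone h S" "single i (x i) \<in> S" "single k (x k) \<in> S"
  shows "restrict_to x {i, k} \<in> S"
proof -
  have "left_sum (single i (x i)) (single k (x k)) = restrict_to x {i, k}"
  proof
    fix l
    show "left_sum (single i (x i)) (single k (x k)) l = restrict_to x {i, k} l"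
      by (cases "x l") (auto simp: left_sum_def single_def restrict_to_def)
  qed
  with tcone_left_sum[OF assms] show ?thesis by simp
qed

lemma sg_mult_eq: "sg k * v = w \<longleftrightarrow> v = sg k * w"
  using sg_simps(2) by metis

text \<open>The dominating coordinate serves as the anchor for \<open>tcone_pairs\<close>.\<close>

lemma P_if_dominated:
  assumes x: "\<And>k. x k \<in> tsigned" "x h \<notin> tnegative"
    and dom: "(\<lambda>k. sg k * x k) \<in> dominated active outweighs"
  shows "x \<in> P"
proof -
  obtain i a where i: "i \<in> active" "sg i * x i = TPos a"
    and R: "\<And>j b. j \<in> active \<Longrightarrow> sg j * x j = TNeg b \<Longrightarrow> outweighs i a j b"
    using dom unfolding dominated_def by blast
  have xi: "x i = sg i * TPos a" using i by (simp add: sg_mult_eq)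
  then have "i \<noteq> h" using x(2) by (auto simp: sg_h tnegative_iff)
  note si = single_pos[OF i(1) \<open>i \<noteq> h\<close>, of a, folded xi]
  show ?thesis
  proof (rule tcone_pairs[OF P_tcone])
    fix k
    show "restrict_to x {i, k} \<in> P"
    proof (cases "k \<in> active")
      case True
      have r0: "restrict_to x {i, k} = single i (x i)" if "k = i \<or> x k = TZero"
        using that by (auto simp: restrict_to_def single_def)
      have "sg k * x k \<in> tsigned" using x by (simp add: sg_simps)
      then consider "x k = TZero" | b where "sg k * x k = TPos b" | b where "sg k * x k = TNeg b"
        by (cases "sg k * x k") (auto simp: tsigned_iff sg_simps)
      then show ?thesis
      proof cases
        case 1
        then show ?thesis using si r0 by simp
      next
        case 2
        then have xk: "x k = sg k * TPos b" by (simp add: sg_mult_eq)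
        then have "k \<noteq> h" using x(2) by (auto simp: sg_h tnegative_iff)
        from single_pos[OF True this, of b] show ?thesis
          using restrict_pair_singles[where x = x, OF P_tcone si] xk by simp
      next
        case 3
        then have xk: "x k = sg k * TNeg b" by (simp add: sg_mult_eq)
        have "restrict_to x {i, k} = pair i a k b" using 3 i(2) by (auto simp: restrict_to_def pair_def xi xk)
        then show ?thesis using R[OF True 3] \<open>i \<noteq> h\<close> by (simp add: outweighs_def)
      qed
    next
      case False
      then have ki: "k \<noteq> i" "k \<noteq> h" using i h_active by auto
      show ?thesis
      \<comment> \<open>Both halves of the inactive axis \<open>k\<close> lie in \<open>N\<close>,
        so \<open>x k\<close> can be cancelled within \<open>N\<close>, which would put the
        half-axis of \<open>i\<close> there.\<close>
      proof (rule ccontr)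
        assume "\<not> ?thesis"
        then have "restrict_to x {i, k} \<in> N"
          by (subst N_iff) (use x ki \<open>i \<noteq> h\<close> in \<open>auto simp: restrict_to_def tnegative_iff\<close>)
        moreover have "TNeg 0 * x k \<in> tsigned" using x(1)[of k] by (cases "x k") (auto simp: tsigned_iff)
        with single_inactive[OF False] have "single k (TNeg 0 * x k) \<in> N" by blast
        moreover have "eliminates k (restrict_to x {i, k}) (single k (TNeg 0 * x k)) (single i (x i))"
          using ki x by (auto simp: eliminates_def restrict_to_def single_def)
        ultimately have "single i (x i) \<in> N" using tcone_eliminate[OF N_tcone] ki by blast
        with si disjoint show False by blast
      qed
    qed
  qed
qed

lemma N_if_opposite:
  assumes x: "\<And>k. x k \<in> tsigned" "x h \<notin> tnegative"
    and j: "j \<in> active" "sg j * x j = TNeg b"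
    and R: "\<And>i a. i \<in> active \<Longrightarrow> sg i * x i = TPos a \<Longrightarrow> \<not> outweighs i a j b"
  shows "x \<in> N"
proof (rule tcone_pairs[OF N_tcone])
  fix k
  have xj: "x j = sg j * TNeg b" using j by (simp add: sg_mult_eq)
  note sj = single_neg[OF j(1), of b, folded xj]
  show "restrict_to x {j, k} \<in> N"
  proof (cases "k \<in> active")
    case True
    have "sg k * x k \<in> tsigned" using x by (simp add: sg_simps)
    then consider "x k = TZero" | a where "sg k * x k = TPos a" | a where "sg k * x k = TNeg a"
      by (cases "sg k * x k") (auto simp: tsigned_iff sg_simps)
    then show ?thesis
    proof cases
      case 1
      then have "single k (x k) \<in> N" using zero by (simp add: single_def)
      with restrict_pair_singles[where x = x, OF N_tcone sj] show ?thesis by blast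
    next
      case 2
      then have xk: "x k = sg k * TPos a" by (simp add: sg_mult_eq)
      then have "k \<noteq> h" using x(2) by (auto simp: sg_h tnegative_iff)
      have "restrict_to x {j, k} = pair k a j b" using 2 j(2) by (auto simp: restrict_to_def pair_def xj xk)
      moreover have "pair k a j b \<notin> P" using R[OF True 2] \<open>k \<noteq> h\<close> by (simp add: outweighs_def)
      ultimately show ?thesis using \<open>k \<noteq> h\<close> by (simp add: pair_N_iff)
    next
      case 3
      then have xk: "x k = sg k * TNeg a" by (simp add: sg_mult_eq)
      from single_neg[OF True, of a] show ?thesis
        using restrict_pair_singles[where x = x, OF N_tcone sj] xk by simp
    qed
  next
    case False
    from restrict_pair_singles[where x = x, OF N_tcone sj single_inactive[OF False x(1)]] show ?thesis .
  qed
qed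

lemma N_if_zero:
  assumes x: "\<And>k. x k \<in> tsigned" and z: "\<And>k. k \<in> active \<Longrightarrow> x k = TZero"
  shows "x \<in> N"
proof (rule tcone_pairs[OF N_tcone])
  fix k
  have s: "single k (x k) \<in> N" for k
    using single_inactive[OF _ x] z zero by (cases "k \<in> active") (auto simp: single_def)
  show "restrict_to x {h, k} \<in> N" by (rule restrict_pair_singles[OF N_tcone s s])
qed

text \<open>Each alternative of \<open>dominated_cases\<close> implies membership in one cone. As
  they are exhaustive and the cones disjoint, the implications become equivalences.\<close>

lemma membership_cases:
  assumes x: "\<And>k. x k \<in> tsigned" "x h \<notin> tnegative"
  shows P_eq_dominated: "x \<in> P \<longleftrightarrow> (\<lambda>k. sg k * x k) \<in> dominated active outweighs"
    and N_eq_dominated: "x \<in> N \<longleftrightarrow> (\<forall>k\<in>active. x k = TZero) \<or>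
      (\<lambda>k. TNeg 0 * (sg k * x k)) \<in> dominated active (\<lambda>i a j b. \<not> outweighs j b i a)"
proof -
  interpret dominance active outweighs by (rule dominance_outweighs)
  let ?u = "\<lambda>k. sg k * x k"
  have u: "?u k \<in> tsigned" for k using x by (simp add: sg_simps)
  have neg: "TNeg 0 * v = TPos b \<longleftrightarrow> v = TNeg b" "TNeg 0 * v = TNeg b \<longleftrightarrow> v = TPos b"
    "TNeg 0 * v \<in> tsigned \<longleftrightarrow> v \<in> tsigned" for v b
    by (cases v; auto simp: tsigned_iff)+
  have dual: "(\<lambda>k. TNeg 0 * ?u k) \<in> dominated active (\<lambda>i a j b. \<not> outweighs j b i a) \<longleftrightarrow>
      (\<exists>j\<in>active. \<exists>b. ?u j = TNeg b \<and> (\<forall>i\<in>active. \<forall>a. ?u i = TPos a \<longrightarrow> \<not> outweighs i a j b))"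
    using u by (simp add: dominated_def neg)
  have Nd: "x \<in> N" if "(\<lambda>k. TNeg 0 * ?u k) \<in> dominated active (\<lambda>i a j b. \<not> outweighs j b i a)"
    using that N_if_opposite[where x = x, OF x] unfolding dual by blast
  have Nz: "x \<in> N" if "\<forall>k\<in>active. x k = TZero"
    by (rule N_if_zero[OF x(1)]) (use that in blast)
  have Pd: "x \<in> P" if "?u \<in> dominated active outweighs"
    using that P_if_dominated[where x = x, OF x] by blast
  have "(\<forall>k\<in>active. x k = TZero) \<or> ?u \<in> dominated active outweighs \<or>
      (\<lambda>k. TNeg 0 * ?u k) \<in> dominated active (\<lambda>i a j b. \<not> outweighs j b i a)"
    using dominated_cases[of ?u, OF u] unfolding dual by (simp add: sg_simps)
  with Nd Nz Pd disjoint
  show "x \<in> P \<longleftrightarrow> (\<lambda>k. sg k * x k) \<in> dominated active outweighs"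
    and "x \<in> N \<longleftrightarrow> (\<forall>k\<in>active. x k = TZero) \<or>
      (\<lambda>k. TNeg 0 * (sg k * x k)) \<in> dominated active (\<lambda>i a j b. \<not> outweighs j b i a)"
    by blast+
qed

end

section \<open>From TC-convex sets to tropical cones\<close>

lemma tnorm_add: "tnorm (x + y) = max (tnorm x) (tnorm y)"
  by (cases x; cases y) (auto simp: plus_symtrop_def)

lemma tnorm_mult: "tnorm (x * y) = tnorm x + tnorm y"
  by (cases x; cases y) auto

lemma add_negative_iff:
  "x + y \<in> tnegative \<longleftrightarrow>
    (tnorm x = tnorm (x + y) \<longrightarrow> x \<in> tnegative) \<and> (tnorm y = tnorm (x + y) \<longrightarrow> y \<in> tnegative)"
  by (cases x; cases y) (auto simp: plus_symtrop_def tnegative_iff)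

lemma negative_norm: "x \<in> tnegative \<Longrightarrow> tnorm x \<noteq> -\<infinity>"
  by (auto simp: tnegative_iff)

lemma tnorm_sum_ge: "finite B \<Longrightarrow> i \<in> B \<Longrightarrow> tnorm (f i) \<le> tnorm (sum f B)"
  by (induction B rule: finite_induct) (auto simp: tnorm_add max.coboundedI2)

lemma tnorm_sum_attained: "finite B \<Longrightarrow> B \<noteq> {} \<Longrightarrow> \<exists>i\<in>B. tnorm (f i) = tnorm (sum f B)"
proof (induction B rule: finite_ne_induct)
  case (insert x B)
  then show ?case by (auto simp: tnorm_add max_def)
qed simp

text \<open>The terms of maximal norm decide the sign, and a disagreement among them makes the sum
  balanced.\<close>

lemma sum_negative_iff:
  assumes "finite B" "B \<noteq> {}"
  shows "sum f B \<in> tnegative \<longleftrightarrow> (\<forall>i\<in>B. tnorm (f i) = tnorm (sum f B) \<longrightarrow> f i \<in> tnegative)"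
  using assms
proof (induction B rule: finite_ne_induct)
  case (insert x B)
  have "(tnorm (sum f B) = tnorm (sum f (insert x B)) \<longrightarrow> sum f B \<in> tnegative) \<longleftrightarrow>
      (\<forall>i\<in>B. tnorm (f i) = tnorm (sum f (insert x B)) \<longrightarrow> f i \<in> tnegative)"
  proof (cases "tnorm (sum f B) = tnorm (sum f (insert x B))")
    case True
    then show ?thesis using insert.IH by simp
  next
    case False
    then have "tnorm (sum f B) < tnorm (sum f (insert x B))"
      using insert.hyps by (auto simp: tnorm_add max_def split: if_splits)
    then have "tnorm (f i) \<noteq> tnorm (sum f (insert x B))" if "i \<in> B" for i
      using tnorm_sum_ge[OF insert.hyps(1) that, of f] by (simp add: not_le)
    with False show ?thesis by blast
  qed
  then show ?case using insert.hyps by (simp add: add_negative_iff)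
qed simp

lemma sum_negativeI:
  fixes g :: "'i::finite \<Rightarrow> symtrop"
  assumes "\<And>i. tnorm (g i) \<le> tnorm (g j)" "\<And>i. tnorm (g i) = tnorm (g j) \<Longrightarrow> g i \<in> tnegative"
  shows "sum g UNIV \<in> tnegative"
proof -
  obtain i where "tnorm (g i) = tnorm (sum g UNIV)" using tnorm_sum_attained[of UNIV g] by auto
  then have "tnorm (sum g UNIV) = tnorm (g j)"
    using assms(1)[of i] tnorm_sum_ge[of UNIV j g] by simp
  then show ?thesis using assms(2) sum_negative_iff[of UNIV g] by simp
qed

text \<open>No closed halfspace contains \<open>x\<close> and \<open>y\<close> but not \<open>z\<close>, in homogeneous coordinates.\<close>

definition inseparable :: "('i::finite \<Rightarrow> symtrop) \<Rightarrow> ('i \<Rightarrow> symtrop) \<Rightarrow> ('i \<Rightarrow> symtrop) \<Rightarrow> bool" where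
  "inseparable x y z \<longleftrightarrow> (\<forall>a. (\<forall>k. a k \<in> tsigned) \<longrightarrow> (\<Sum>k\<in>UNIV. a k * z k) \<in> tnegative \<longrightarrow>
     (\<Sum>k\<in>UNIV. a k * x k) \<in> tnegative \<or> (\<Sum>k\<in>UNIV. a k * y k) \<in> tnegative)"

section \<open>Inseparability of left sums and eliminations\<close>

lemma tnorm_mult_mono: "tnorm x \<le> tnorm y \<Longrightarrow> tnorm (a * x) \<le> tnorm (a * y)"
  by (simp add: tnorm_mult add_left_mono)

lemma tnorm_mult_cancel: "tnorm (a * x) = tnorm (a * y) \<Longrightarrow> tnorm (a * y) \<noteq> -\<infinity> \<Longrightarrow> tnorm x = tnorm y"
  by (cases a; cases x; cases y) auto

text \<open>Off \<open>k\<close>, a term of \<open>x\<close> reaching the norm of the sum for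
  \<open>z\<close> equals the term of \<open>z\<close> and is negative. The term at \<open>k\<close>
  either is negative and at least as large, or is smaller while the norm is attained
  elsewhere.\<close>

lemma negative_of_dominating:
  fixes x z :: "'i::finite \<Rightarrow> symtrop"
  assumes neg: "(\<Sum>k\<in>UNIV. a k * z k) \<in> tnegative"
    and le: "\<And>i. i \<noteq> k \<Longrightarrow> tnorm (x i) \<le> tnorm (z i)"
    and eq: "\<And>i. i \<noteq> k \<Longrightarrow> tnorm (x i) = tnorm (z i) \<Longrightarrow> x i = z i"
    and top: "a k * x k \<in> tnegative \<and> tnorm (\<Sum>k\<in>UNIV. a k * z k) \<le> tnorm (a k * x k) \<or>
      tnorm (a k * x k) < tnorm (\<Sum>k\<in>UNIV. a k * z k) \<and>
        (\<exists>j. j \<noteq> k \<and> tnorm (a j * x j) = tnorm (\<Sum>k\<in>UNIV. a k * z k))"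
  shows "(\<Sum>k\<in>UNIV. a k * x k) \<in> tnegative"
proof -
  define M where "M = tnorm (\<Sum>k\<in>UNIV. a k * z k)"
  have M: "M \<noteq> -\<infinity>" using negative_norm[OF neg] by (simp add: M_def)
  have zM: "tnorm (a i * z i) \<le> M" for i
    unfolding M_def using tnorm_sum_ge[of UNIV i "\<lambda>k. a k * z k"] by simp
  have negz: "a i * z i \<in> tnegative" if "tnorm (a i * z i) = M" for i
    using that neg sum_negative_iff[of UNIV "\<lambda>k. a k * z k"] by (simp add: M_def)
  have xM: "tnorm (a i * x i) \<le> M" if "i \<noteq> k" for i
    using tnorm_mult_mono[OF le[OF that]] zM order_trans by blast
  have negx: "a i * x i \<in> tnegative" if "i \<noteq> k" "tnorm (a i * x i) = M" for i
  proof -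
    have az: "tnorm (a i * z i) = M"
      using tnorm_mult_mono[OF le[OF that(1)], of "a i"] zM[of i] that(2) by simp
    then have "tnorm (x i) = tnorm (z i)" using tnorm_mult_cancel that(2) M by metis
    then show ?thesis using eq[OF that(1)] negz[OF az] by simp
  qed
  from top show ?thesis
  proof (elim disjE conjE exE)
    assume k: "a k * x k \<in> tnegative" "tnorm (\<Sum>k\<in>UNIV. a k * z k) \<le> tnorm (a k * x k)"
    show ?thesis
    proof (rule sum_negativeI[of _ k])
      show "tnorm (a i * x i) \<le> tnorm (a k * x k)" for i
        using xM[of i] k(2) by (cases "i = k") (auto simp: M_def)
      show "a i * x i \<in> tnegative" if "tnorm (a i * x i) = tnorm (a k * x k)" for i
        using negx[of i] xM[of i] k that by (cases "i = k") (auto simp: M_def)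
    qed
  next
    fix j
    assume k: "tnorm (a k * x k) < tnorm (\<Sum>k\<in>UNIV. a k * z k)"
      and j: "j \<noteq> k" "tnorm (a j * x j) = tnorm (\<Sum>k\<in>UNIV. a k * z k)"
    show ?thesis
    proof (rule sum_negativeI[of _ j])
      show "tnorm (a i * x i) \<le> tnorm (a j * x j)" for i
        using xM[of i] k j(2) by (cases "i = k") (auto simp: M_def)
      show "a i * x i \<in> tnegative" if "tnorm (a i * x i) = tnorm (a j * x j)" for i
        using negx[of i] k j(2) that by (cases "i = k") (auto simp: M_def)
    qed
  qed
qed

text \<open>If some maximal term for \<open>z\<close> stems from \<open>x\<close>, all maximal terms
  for \<open>x\<close> are terms for \<open>z\<close>, because ties go to \<open>x\<close>.
  Otherwise all maximal terms for \<open>z\<close> stem from \<open>y\<close>.\<close>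

lemma inseparable_left_sum: "inseparable x y (left_sum x y)"
  unfolding inseparable_def
proof (intro allI impI)
  fix a :: "'a \<Rightarrow> symtrop"
  let ?z = "left_sum x y"
  define M where "M = tnorm (\<Sum>k\<in>UNIV. a k * ?z k)"
  assume neg: "(\<Sum>k\<in>UNIV. a k * ?z k) \<in> tnegative"
  have M: "M \<noteq> -\<infinity>" using negative_norm[OF neg] by (simp add: M_def)
  have zM: "tnorm (a i * ?z i) \<le> M" for i
    unfolding M_def using tnorm_sum_ge[of UNIV i "\<lambda>k. a k * ?z k"] by simp
  have negz: "a i * ?z i \<in> tnegative" if "tnorm (a i * ?z i) = M" for i
    using that neg sum_negative_iff[of UNIV "\<lambda>k. a k * ?z k"] by (simp add: M_def)
  have le: "tnorm (x i) \<le> tnorm (?z i)" "tnorm (y i) \<le> tnorm (?z i)" for i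
    by (auto simp: left_sum_def)
  have xM: "tnorm (a i * x i) \<le> M" and yM: "tnorm (a i * y i) \<le> M" for i
    using tnorm_mult_mono[OF le(1)] tnorm_mult_mono[OF le(2)] zM order_trans by blast+
  show "(\<Sum>k\<in>UNIV. a k * x k) \<in> tnegative \<or> (\<Sum>k\<in>UNIV. a k * y k) \<in> tnegative"
  proof (cases "\<exists>j. tnorm (a j * ?z j) = M \<and> ?z j = x j")
    case True
    then obtain j where j: "tnorm (a j * x j) = M" by auto
    have "(\<Sum>k\<in>UNIV. a k * x k) \<in> tnegative"
    proof (rule sum_negativeI[of _ j])
      fix i
      show "tnorm (a i * x i) \<le> tnorm (a j * x j)" using xM j by simp
      assume "tnorm (a i * x i) = tnorm (a j * x j)"
      then have i: "tnorm (a i * x i) = M" using j by simp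
      then have az: "tnorm (a i * ?z i) = M"
        using tnorm_mult_mono[OF le(1), of "a i" i] zM[of i] by simp
      then have "tnorm (x i) = tnorm (?z i)" using tnorm_mult_cancel i M by metis
      then have "?z i = x i" by (auto simp: left_sum_def split: if_splits)
      then show "a i * x i \<in> tnegative" using negz[OF az] by simp
    qed
    then show ?thesis ..
  next
    case False
    then have zy: "?z j = y j" if "tnorm (a j * ?z j) = M" for j
      using that by (auto simp: left_sum_def)
    obtain j where j: "tnorm (a j * ?z j) = M"
      using tnorm_sum_attained[of UNIV "\<lambda>k. a k * ?z k"] by (auto simp: M_def)
    have "(\<Sum>k\<in>UNIV. a k * y k) \<in> tnegative"
    proof (rule sum_negativeI[of _ j])
      fix i
      show "tnorm (a i * y i) \<le> tnorm (a j * y j)" using yM j zy[OF j] by simp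
      assume "tnorm (a i * y i) = tnorm (a j * y j)"
      then have az: "tnorm (a i * ?z i) = M"
        using tnorm_mult_mono[OF le(2), of "a i" i] zM[of i] j zy[OF j] by simp
      then show "a i * y i \<in> tnegative" using negz[OF az] zy[OF az] by simp
    qed
    then show ?thesis ..
  qed
qed

lemma signed_add_eq:
  assumes "x + y \<in> tsigned" "tnorm x = tnorm (x + y)"
  shows "x = x + y"
proof -
  have "tnorm y \<le> tnorm x" using assms(2) by (simp add: tnorm_add max_def split: if_splits)
  with assms(1) show ?thesis
    by (cases x; cases y) (auto simp: plus_symtrop_def tsigned_iff split: if_splits)
qed

text \<open>The terms of \<open>x\<close> and \<open>y\<close> at \<open>k\<close> are opposite. If
  they reach the norm of the sum for \<open>z\<close>, the negative one makes its sum negative.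
  Otherwise a maximal term for \<open>z\<close> lies off \<open>k\<close>, and its norm is attained
  by \<open>x\<close> or \<open>y\<close> there.\<close>

lemma inseparable_eliminates:
  assumes el: "eliminates k x y z" and xk: "x k \<in> tsigned"
  shows "inseparable x y z"
  unfolding inseparable_def
proof (intro allI impI)
  fix a :: "'a \<Rightarrow> symtrop"
  define M where "M = tnorm (\<Sum>k\<in>UNIV. a k * z k)"
  assume a: "\<forall>k. a k \<in> tsigned" and neg: "(\<Sum>k\<in>UNIV. a k * z k) \<in> tnegative"
  have M: "M \<noteq> -\<infinity>" using negative_norm[OF neg] by (simp add: M_def)
  have yk: "y k = TNeg 0 * x k" and zk: "z k = TZero"
    and z: "\<And>i. i \<noteq> k \<Longrightarrow> z i = x i + y i" "\<And>i. z i \<in> tsigned"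
    using el by (auto simp: eliminates_def)
  have x_le: "tnorm (x i) \<le> tnorm (z i)" "tnorm (x i) = tnorm (z i) \<Longrightarrow> x i = z i" if "i \<noteq> k" for i
    using z(1)[OF that] z(2)[of i] signed_add_eq[of "x i" "y i"] by (simp_all add: tnorm_add)
  have y_le: "tnorm (y i) \<le> tnorm (z i)" "tnorm (y i) = tnorm (z i) \<Longrightarrow> y i = z i" if "i \<noteq> k" for i
    using z(1)[OF that] z(2)[of i] signed_add_eq[of "y i" "x i"]
    by (simp_all add: tnorm_add add.commute[of "y i"])
  have rx: "(\<Sum>k\<in>UNIV. a k * x k) \<in> tnegative"
    if "a k * x k \<in> tnegative \<and> M \<le> tnorm (a k * x k) \<or>
      tnorm (a k * x k) < M \<and> (\<exists>j. j \<noteq> k \<and> tnorm (a j * x j) = M)"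
    by (rule negative_of_dominating[where k = k and z = z, OF neg])
      (use x_le that[unfolded M_def] in blast)+
  have ry: "(\<Sum>k\<in>UNIV. a k * y k) \<in> tnegative"
    if "a k * y k \<in> tnegative \<and> M \<le> tnorm (a k * y k) \<or>
      tnorm (a k * y k) < M \<and> (\<exists>j. j \<noteq> k \<and> tnorm (a j * y j) = M)"
    by (rule negative_of_dominating[where k = k and z = z, OF neg])
      (use y_le that[unfolded M_def] in blast)+
  have norm_k: "tnorm (a k * y k) = tnorm (a k * x k)" by (simp add: yk tnorm_mult)
  show "(\<Sum>k\<in>UNIV. a k * x k) \<in> tnegative \<or> (\<Sum>k\<in>UNIV. a k * y k) \<in> tnegative"
  proof (cases "M \<le> tnorm (a k * x k)")
    case True
    then have "tnorm (a k * x k) \<noteq> -\<infinity>" using M by auto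
    then have "a k * x k \<in> tnegative \<or> a k * y k \<in> tnegative"
      using xk a[rule_format, of k] by (cases "a k"; cases "x k") (auto simp: yk tsigned_iff tnegative_iff)
    then show ?thesis
    proof
      assume "a k * x k \<in> tnegative"
      then show ?thesis using rx True by blast
    next
      assume "a k * y k \<in> tnegative"
      then show ?thesis using ry True norm_k by simp
    qed
  next
    case False
    obtain j where j: "tnorm (a j * z j) = M"
      using tnorm_sum_attained[of UNIV "\<lambda>k. a k * z k"] by (auto simp: M_def)
    then have "j \<noteq> k" using zk M by auto
    have "tnorm (z j) = tnorm (x j) \<or> tnorm (z j) = tnorm (y j)"
      using z(1)[OF \<open>j \<noteq> k\<close>] by (auto simp: tnorm_add max_def)
    then have "tnorm (a j * x j) = M \<or> tnorm (a j * y j) = M" using j by (auto simp: tnorm_mult)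
    then show ?thesis
    proof
      assume "tnorm (a j * x j) = M"
      then show ?thesis using rx False \<open>j \<noteq> k\<close> by (simp add: not_le) blast
    next
      assume "tnorm (a j * y j) = M"
      then show ?thesis using ry False norm_k \<open>j \<noteq> k\<close> by (simp add: not_le) blast
    qed
  qed
qed

lemma TPos_mult_negative_iff: "TPos c * x \<in> tnegative \<longleftrightarrow> x \<in> tnegative"
  by (cases x) (auto simp: tnegative_iff)

lemma inseparable_scale:
  fixes x y z :: "'i::finite \<Rightarrow> symtrop"
  shows "inseparable (\<lambda>k. TPos c * x k) (\<lambda>k. TPos d * y k) z \<longleftrightarrow> inseparable x y z"
proof -
  have "(\<Sum>k\<in>UNIV. a k * (TPos c * x k)) = TPos c * (\<Sum>k\<in>UNIV. a k * x k)"
    for a c and x :: "'i \<Rightarrow> symtrop"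
    by (simp add: sum_distrib_left mult.left_commute)
  then show ?thesis by (simp add: inseparable_def TPos_mult_negative_iff)
qed

section \<open>Homogeneous coordinates\<close>

definition homogenize :: "symtrop ^ 'n \<Rightarrow> 'n option \<Rightarrow> symtrop" where
  "homogenize x = case_option (TPos 0) (\<lambda>i. x $ i)"

lemma hom_simps [simp]: "homogenize x None = TPos 0" "homogenize x (Some i) = x $ i"
  by (simp_all add: homogenize_def)

lemma sum_option: "(\<Sum>k\<in>UNIV. f k) = f None + (\<Sum>i\<in>UNIV. f (Some i))"
  for f :: "'n::finite option \<Rightarrow> 'b::comm_monoid_add"
  by (simp add: UNIV_option_conv sum.reindex)

lemma conv_TC_I:
  fixes x y z :: "symtrop ^ 'n::finite"
  assumes z: "z \<in> signed_space" and sep: "inseparable (homogenize x) (homogenize y) (homogenize z)"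
  shows "z \<in> conv_TC x y"
  unfolding conv_TC_def
proof (intro InterI, elim CollectE conjE)
  fix H
  assume H: "H \<in> closed_halfspaces" "x \<in> H" "y \<in> H"
  then obtain a0 and a :: "symtrop ^ 'n" where a: "a0 \<in> tsigned" "a \<in> signed_space" "H = closed_halfspace a0 a"
    by (auto simp: closed_halfspaces_def)
  define b where "b = case_option a0 (\<lambda>i. a $ i)"
  have b: "\<forall>k. b k \<in> tsigned"
    using a by (auto simp: b_def signed_space_def split: option.split)
  have "a0 * TPos 0 = a0" using mult_1_right[of a0] by (simp only: one_symtrop_def)
  then have lin: "(\<Sum>k\<in>UNIV. b k * homogenize w k) = a0 + (\<Sum>i\<in>UNIV. a $ i * w $ i)" for w
    by (simp add: sum_option b_def)
  have nn: "v \<in> tpositive \<union> tbalanced \<longleftrightarrow> v \<notin> tnegative" for v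
    by (cases v) (auto simp: tpositive_def tbalanced_def tnegative_def)
  have Hiff: "w \<in> H \<longleftrightarrow> w \<in> signed_space \<and> (\<Sum>k\<in>UNIV. b k * homogenize w k) \<notin> tnegative" for w
    unfolding a(3) closed_halfspace_def lin nn by simp
  show "z \<in> H" using H z b sep unfolding Hiff inseparable_def by blast
qed

lemma TC_convexD:
  assumes "TC_convex S" "x \<in> S" "y \<in> S" "z \<in> signed_space" "inseparable (homogenize x) (homogenize y) (homogenize z)"
  shows "z \<in> S"
  using assms conv_TC_I unfolding TC_convex_def by blast

text \<open>The factor is free and not computed from the coordinate \<open>None\<close>, so that
  vectors at infinity are covered.\<close>

definition affine_part :: "real \<Rightarrow> ('n::finite option \<Rightarrow> symtrop) \<Rightarrow> symtrop ^ 'n" where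
  "affine_part c x = (\<chi> i. TPos c * x (Some i))"

lemma TPos_mult_mult: "TPos c * (TPos d * x) = TPos (c + d) * x"
  by (cases x) auto

lemma TPos_mult_signed: "TPos c * x \<in> tsigned \<longleftrightarrow> x \<in> tsigned"
  by (cases x) (auto simp: tsigned_iff)

lemma affine_part_signed: "(\<And>k. x k \<in> tsigned) \<Longrightarrow> affine_part c x \<in> signed_space"
  by (simp add: affine_part_def signed_space_def TPos_mult_signed)

text \<open>
  The exponents \<open>\<sigma>\<close> and \<open>\<tau>\<close> are the weights of an affine combination, whence the
  normalisation \<open>max \<sigma> \<tau> = 0\<close>.
\<close>

lemma TC_convex_combination:
  fixes x y z :: "'n::finite option \<Rightarrow> symtrop"
  assumes S: "TC_convex S" and x: "affine_part (\<nu> - \<sigma>) x \<in> S" and y: "affine_part (\<nu> - \<tau>) y \<in> S"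
    and max: "max \<sigma> \<tau> = 0" and signed: "\<And>k. x k \<in> tsigned" "\<And>k. y k \<in> tsigned"
    and z: "z = left_sum x y \<or> (\<exists>k. k \<noteq> None \<and> eliminates k x y z)"
  shows "affine_part \<nu> z \<in> S"
proof -
  \<comment> \<open>\<open>X c w\<close> is \<open>TPos c\<close> times the homogenisation of
    \<open>affine_part (\<nu> - c) w\<close>. As \<open>\<nu>\<close> is common to all,
    \<open>max \<sigma> \<tau> = 0\<close> makes the homogenising coordinate of the combination the
    unit.\<close>
  define X where "X c w = case_option (TPos c) (\<lambda>i. TPos \<nu> * w (Some i))" for c and w :: "'n option \<Rightarrow> symtrop"
  have hom_X: "(\<lambda>k. TPos c * homogenize (affine_part (\<nu> - c) w) k) = X c w" for c w
    by (auto simp: X_def affine_part_def TPos_mult_mult fun_eq_iff split: option.split)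
  have hom_z: "homogenize (affine_part \<nu> w) = X 0 w" for w
    by (auto simp: X_def affine_part_def fun_eq_iff homogenize_def split: option.split)
  have zs: "z k \<in> tsigned" for k
    using z signed by (auto simp: left_sum_def eliminates_def)
  have "inseparable (X \<sigma> x) (X \<tau> y) (X 0 z)"
    using z
  proof (elim disjE exE conjE)
    assume zl: "z = left_sum x y"
    have "X 0 z = left_sum (X \<sigma> x) (X \<tau> y)"
    proof
      fix k
      show "X 0 z k = left_sum (X \<sigma> x) (X \<tau> y) k"
      proof (cases k)
        case None
        then show ?thesis using max by (auto simp: X_def left_sum_def max_def split: if_splits)
      next
        case (Some i)
        have "tnorm (TPos \<nu> * v) \<le> tnorm (TPos \<nu> * w) \<longleftrightarrow> tnorm v \<le> tnorm w" for v w
          by (cases v; cases w) auto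
        then show ?thesis using Some by (simp add: X_def zl left_sum_def)
      qed
    qed
    then show ?thesis by (simp add: inseparable_left_sum)
  next
    fix k assume k: "k \<noteq> None" "eliminates k x y z"
    have "eliminates k (X \<sigma> x) (X \<tau> y) (X 0 z)"
      unfolding eliminates_def
    proof (intro conjI allI impI)
      obtain i where i: "k = Some i" using k by auto
      show "X \<tau> y k = TNeg 0 * X \<sigma> x k"
        using k(2) by (simp add: X_def i eliminates_def mult.left_commute)
      show "X 0 z k = TZero" using k(2) by (simp add: X_def i eliminates_def)
      show "X 0 z j = X \<sigma> x j + X \<tau> y j" if "j \<noteq> k" for j
      proof (cases j)
        case None
        then show ?thesis using max by (auto simp: X_def plus_symtrop_def max_def split: if_splits)
      next
        case (Some l)
        then show ?thesis using k(2) that by (simp add: X_def eliminates_def distrib_left)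
      qed
      show "X 0 z j \<in> tsigned" for j
        using zs by (cases j) (auto simp: X_def TPos_mult_signed tsigned_iff[of "TPos 0"])
    qed
    moreover have "X \<sigma> x k \<in> tsigned"
      using signed by (cases k) (auto simp: X_def TPos_mult_signed tsigned_iff[of "TPos \<sigma>"])
    ultimately show ?thesis by (rule inseparable_eliminates)
  qed
  then have "inseparable (homogenize (affine_part (\<nu> - \<sigma>) x)) (homogenize (affine_part (\<nu> - \<tau>) y)) (homogenize (affine_part \<nu> z))"
    unfolding hom_z hom_X[symmetric] inseparable_scale .
  then show ?thesis using TC_convexD[OF S x y affine_part_signed[of z]] zs by blast
qed

section \<open>The cone over a hemispace that avoids the origin\<close>

locale hemispace =
  fixes Q :: "(symtrop ^ 'n::finite) set"
  assumes hemispace: "TC_hemispace Q" and origin: "(\<chi> i. TZero) \<notin> Q"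
begin

lemma Q_convex: "TC_convex Q" and compl_convex: "TC_convex (signed_space - Q)"
  using hemispace by (simp_all add: TC_hemispace_def)

definition nonneg_dom :: "('n option \<Rightarrow> symtrop) set" where
  "nonneg_dom = {x. (\<forall>k. x k \<in> tsigned) \<and> x None \<notin> tnegative}"

text \<open>
  A vector lies in the cone over \<open>Q\<close> iff it can be scaled into \<open>Q\<close> without its homogenising
  coordinate exceeding the unit; as the origin lies outside of \<open>Q\<close>, the admissible scaling
  factors are upward closed. This also decides the vectors at infinity.
\<close>

definition tropical_cone :: "('n option \<Rightarrow> symtrop) set" where
  "tropical_cone = {x \<in> nonneg_dom. \<exists>c. tnorm (x None) + ereal c \<le> 0 \<and> affine_part c x \<in> Q}"

lemma not_cone_iff:
  "x \<in> nonneg_dom - tropical_cone \<longleftrightarrow> x \<in> nonneg_dom \<and> (\<forall>c. tnorm (x None) + ereal c \<le> 0 \<longrightarrow> affine_part c x \<in> signed_space - Q)"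
  using affine_part_signed[of x] by (auto simp: tropical_cone_def nonneg_dom_def)

lemma dom_combination:
  assumes "x \<in> nonneg_dom" "y \<in> nonneg_dom" and z: "z = left_sum x y \<or> (\<exists>k. k \<noteq> None \<and> eliminates k x y z)"
  shows "z \<in> nonneg_dom" "tnorm (z None) = max (tnorm (x None)) (tnorm (y None))"
proof -
  have "z k \<in> tsigned" for k using assms by (auto simp: left_sum_def eliminates_def nonneg_dom_def)
  moreover have "z None \<notin> tnegative"
    using z
  proof (elim disjE exE conjE)
    fix k assume "k \<noteq> None" "eliminates k x y z"
    then have "z None = x None + y None" by (auto simp: eliminates_def)
    then show ?thesis using assms(1,2)
      by (cases "x None"; cases "y None") (auto simp: nonneg_dom_def plus_symtrop_def tnegative_iff)
  qed (use assms in \<open>auto simp: left_sum_def nonneg_dom_def\<close>)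
  ultimately show "z \<in> nonneg_dom" by (simp add: nonneg_dom_def)
  show "tnorm (z None) = max (tnorm (x None)) (tnorm (y None))"
    using z by (auto simp: left_sum_def eliminates_def tnorm_add max_def)
qed

lemma cone_combination:
  assumes x: "x \<in> tropical_cone" and y: "y \<in> tropical_cone"
    and z: "z = left_sum x y \<or> (\<exists>k. k \<noteq> None \<and> eliminates k x y z)"
  shows "z \<in> tropical_cone"
proof -
  obtain c where c: "tnorm (x None) + ereal c \<le> 0" "affine_part c x \<in> Q" using x by (auto simp: tropical_cone_def)
  obtain d where d: "tnorm (y None) + ereal d \<le> 0" "affine_part d y \<in> Q" using y by (auto simp: tropical_cone_def)
  have xy: "x \<in> nonneg_dom" "y \<in> nonneg_dom" using x y by (auto simp: tropical_cone_def)
  \<comment> \<open>A factor admissible for both vectors; the resulting weights \<open>e - c\<close>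
    and \<open>e - d\<close> have maximum 0.\<close>
  define e where "e = min c d"
  have "tnorm (x None) + ereal e \<le> tnorm (x None) + ereal c" "tnorm (y None) + ereal e \<le> tnorm (y None) + ereal d"
    by (auto simp: e_def intro: add_left_mono)
  then have "tnorm (z None) + ereal e \<le> 0"
    using c d dom_combination(2)[OF xy z] by (auto simp: max_def)
  moreover have "affine_part e z \<in> Q"
    by (rule TC_convex_combination[OF Q_convex, of e "e - c" x "e - d" y])
      (use c d xy z in \<open>auto simp: e_def nonneg_dom_def\<close>)
  ultimately show ?thesis using dom_combination(1)[OF xy z] by (auto simp: tropical_cone_def)
qed

text \<open>A factor admissible for \<open>z\<close> is admissible for \<open>x\<close> and
  \<open>y\<close>, so the scaled vectors combine outside of \<open>Q\<close> with both weights
  0.\<close>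

lemma not_cone_combination:
  assumes x: "x \<in> nonneg_dom - tropical_cone" and y: "y \<in> nonneg_dom - tropical_cone"
    and z: "z = left_sum x y \<or> (\<exists>k. k \<noteq> None \<and> eliminates k x y z)"
  shows "z \<in> nonneg_dom - tropical_cone"
proof -
  have xy: "x \<in> nonneg_dom" "y \<in> nonneg_dom" using x y by auto
  have "affine_part c z \<in> signed_space - Q" if c: "tnorm (z None) + ereal c \<le> 0" for c
  proof (rule TC_convex_combination[OF compl_convex, of c 0 x 0 y])
    have "tnorm (x None) + ereal c \<le> tnorm (z None) + ereal c" "tnorm (y None) + ereal c \<le> tnorm (z None) + ereal c"
      using dom_combination(2)[OF xy z] by (auto intro: add_right_mono)
    then have "tnorm (x None) + ereal c \<le> 0" "tnorm (y None) + ereal c \<le> 0" using c by auto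
    then show "affine_part (c - 0) x \<in> signed_space - Q" "affine_part (c - 0) y \<in> signed_space - Q"
      using x y unfolding not_cone_iff by simp_all
  qed (use xy z in \<open>auto simp: nonneg_dom_def\<close>)
  then show ?thesis using dom_combination(1)[OF xy z] unfolding not_cone_iff by blast
qed

lemma scale_dom: "(\<lambda>k. TPos c * x k) \<in> nonneg_dom \<longleftrightarrow> x \<in> nonneg_dom"
  by (simp add: nonneg_dom_def TPos_mult_signed TPos_mult_negative_iff)

lemma scale_cone:
  assumes "x \<in> tropical_cone"
  shows "(\<lambda>k. TPos c * x k) \<in> tropical_cone"
proof -
  obtain d where d: "tnorm (x None) + ereal d \<le> 0" "affine_part d x \<in> Q" using assms by (auto simp: tropical_cone_def)
  have "affine_part (d - c) (\<lambda>k. TPos c * x k) = affine_part d x"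
    by (simp add: affine_part_def TPos_mult_mult)
  moreover have "tnorm (TPos c * x None) + ereal (d - c) = tnorm (x None) + ereal d"
    by (cases "x None") auto
  ultimately have "tnorm (TPos c * x None) + ereal (d - c) \<le> 0 \<and> affine_part (d - c) (\<lambda>k. TPos c * x k) \<in> Q"
    using d by simp
  moreover have "(\<lambda>k. TPos c * x k) \<in> nonneg_dom" using assms scale_dom[of c x] by (simp add: tropical_cone_def)
  ultimately show ?thesis unfolding tropical_cone_def by blast
qed

lemma scale_not_cone:
  assumes "x \<in> nonneg_dom - tropical_cone"
  shows "(\<lambda>k. TPos c * x k) \<in> nonneg_dom - tropical_cone"
proof -
  have "TPos (- c) * (TPos c * v) = v" for v by (cases v) auto
  then show ?thesis using scale_cone[of "\<lambda>k. TPos c * x k" "- c"] assms scale_dom[of c x] by auto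
qed

lemma cone_pair: "cone_pair None tropical_cone (nonneg_dom - tropical_cone)"
proof
  show "tropical_cone \<inter> (nonneg_dom - tropical_cone) = {}" by blast
  show "tropical_cone \<union> (nonneg_dom - tropical_cone) = {x. (\<forall>k. x k \<in> tsigned) \<and> x None \<notin> tnegative}"
    by (auto simp: tropical_cone_def nonneg_dom_def)
  show "tcone None tropical_cone"
    unfolding tcone_def using scale_cone cone_combination by blast
  show "tcone None (nonneg_dom - tropical_cone)"
    unfolding tcone_def using scale_not_cone not_cone_combination by blast
  have "affine_part c (\<lambda>_ :: 'n option. TZero) = (\<chi> i. TZero)"
    "affine_part c (single None (TPos 0) :: 'n option \<Rightarrow> symtrop) = (\<chi> i. TZero)" for c
    by (simp_all add: affine_part_def single_def)
  then show "(\<lambda>_. TZero) \<in> nonneg_dom - tropical_cone" "single None (TPos 0) \<in> nonneg_dom - tropical_cone"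
    using origin by (auto simp: tropical_cone_def nonneg_dom_def tsigned_iff tnegative_iff) (auto simp: single_def split: if_splits)
qed

lemma hom_dom: "x \<in> signed_space \<Longrightarrow> homogenize x \<in> nonneg_dom"
  by (auto simp: nonneg_dom_def signed_space_def homogenize_def tsigned_iff[of "TPos 0"] tnegative_iff split: option.split)

lemma hom_in_cone_iff:
  assumes x: "x \<in> signed_space"
  shows "homogenize x \<in> tropical_cone \<longleftrightarrow> x \<in> Q"
proof
  have part0: "affine_part 0 (homogenize x) = x"
  proof -
    have "TPos 0 * v = v" for v using mult_1_left[of v] by (simp only: one_symtrop_def)
    then show ?thesis by (simp add: affine_part_def)
  qed
  then show "homogenize x \<in> tropical_cone" if "x \<in> Q"
    using that hom_dom[OF x] unfolding tropical_cone_def by (auto intro!: exI[of _ 0])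
  assume "homogenize x \<in> tropical_cone"
  then obtain c where c: "c \<le> 0" "affine_part c (homogenize x) \<in> Q" by (auto simp: tropical_cone_def)
  show "x \<in> Q"
  proof (rule ccontr)
    assume "x \<notin> Q"
    have "affine_part c (homogenize x) \<in> signed_space - Q"
    \<comment> \<open>As \<open>c <= 0\<close>, the scaled point is a combination of the origin with
      weight 0 and \<open>x\<close> with weight \<open>c\<close>.\<close>
    proof (rule TC_convex_combination[OF compl_convex, of c 0 "\<lambda>_. TZero" c "homogenize x"])
      have "affine_part c (\<lambda>_ :: 'n option. TZero) = (\<chi> i. TZero)" by (simp add: affine_part_def)
      then show "affine_part (c - 0) (\<lambda>_. TZero) \<in> signed_space - Q"
        using origin by (simp add: signed_space_def)
      show "affine_part (c - c) (homogenize x) \<in> signed_space - Q" using \<open>x \<notin> Q\<close> x part0 by simp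
      show "homogenize x k \<in> tsigned" for k using hom_dom[OF x] by (simp add: nonneg_dom_def)
      show "homogenize x = left_sum (\<lambda>_. TZero) (homogenize x) \<or> (\<exists>k. k \<noteq> None \<and> eliminates k (\<lambda>_. TZero) (homogenize x) (homogenize x))"
        by (rule disjI1) (auto simp: left_sum_def fun_eq_iff)
    qed (use c in auto)
    with c show False by blast
  qed
qed

end

section \<open>Lifting hemispaces\<close>

lemma puiseux_cone_add:
  assumes "puiseux_cone C" "z \<in> C" "w \<in> C"
  shows "(\<lambda>k. z k + w k) \<in> C"
proof -
  have "\<forall>z\<in>C. \<forall>w\<in>C. (\<lambda>k. z k + w k) \<in> C"
    using assms(1) unfolding puiseux_cone_def by (elim conjE)
  with assms(2,3) show ?thesis by metis
qed

text \<open>The lift is the slice of \<open>C\<close> where the coordinate \<open>None\<close> is 1.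
  A preimage of a homogenised point has there a positive entry of leading exponent 0, and division
  by it preserves signed valuations.\<close>

lemma slice_lift:
  fixes Q :: "(symtrop ^ 'n::finite) set"
  assumes C: "puiseux_cone C" and Q: "Q \<subseteq> signed_space"
    and iff: "\<And>x. x \<in> signed_space \<Longrightarrow> x \<in> Q \<longleftrightarrow> homogenize x \<in> (\<lambda>z k. sval (z k)) ` C"
  shows "\<exists>H :: (puiseux ^ 'n) set. field_convex H \<and> Q = sval_vec ` H"
proof -
  define e where "e x = case_option 1 (\<lambda>i. x $ i)" for x :: "puiseux ^ 'n"
  define H where "H = {x. e x \<in> C}"
  have e_sval: "(\<lambda>k. sval (e x k)) = homogenize (sval_vec x)" for x
    by (auto simp: e_def homogenize_def sval_vec_def sval_one one_symtrop_def fun_eq_iff split: option.split)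
  have "field_convex H"
    unfolding field_convex_def
  proof (intro ballI allI impI)
    fix x y u v assume xy: "x \<in> H" "y \<in> H" and uv: "0 \<le> u" "0 \<le> v" "u + v = (1 :: puiseux)"
    show "u *s x + v *s y \<in> H"
    \<comment> \<open>A vanishing weight leaves an endpoint; cones admit positive factors
      only.\<close>
    proof (cases "u = 0 \<or> v = 0")
      case True
      with uv xy show ?thesis by auto
    next
      case False
      then have "(\<lambda>k. u * e x k) \<in> C" "(\<lambda>k. v * e y k) \<in> C"
        using C xy uv by (auto simp: puiseux_cone_def H_def)
      then have "(\<lambda>k. u * e x k + v * e y k) \<in> C"
        by (rule puiseux_cone_add[OF C])
      moreover have "(\<lambda>k. u * e x k + v * e y k) = e (u *s x + v *s y)"
        using uv(3) by (auto simp: e_def fun_eq_iff split: option.split)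
      ultimately show ?thesis by (simp add: H_def)
    qed
  qed
  moreover have "Q = sval_vec ` H"
  proof
    show "Q \<subseteq> sval_vec ` H"
    proof
      fix x assume x: "x \<in> Q"
      with iff Q obtain z where z: "z \<in> C" "homogenize x = (\<lambda>k. sval (z k))" by blast
      from fun_cong[OF z(2), of None] have z0: "0 < z None" "lead_exp (z None) = 0"
        using sval_eq_simps(1)[of "z None" 0] by simp_all
      define c where "c = inverse (z None)"
      have c: "0 < c" "c * z None = 1" using z0 by (simp_all add: c_def)
      have "lead_exp (c * z None) = lead_exp c + lead_exp (z None)"
        by (rule lead_exp_mult) (use c z0 in auto)
      with c z0 have sc: "sval c = 1" by (simp add: lead_exp_one sval_eq_simps one_symtrop_def)
      define y where "y = (\<chi> i. c * z (Some i))"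
      have "e y = (\<lambda>k. c * z k)" using c by (auto simp: e_def y_def fun_eq_iff split: option.split)
      moreover have "(\<lambda>k. c * z k) \<in> C" using C z c by (simp add: puiseux_cone_def)
      ultimately have "y \<in> H" by (simp add: H_def)
      moreover have "sval_vec y = x"
      proof -
        have "sval (z (Some i)) = x $ i" for i using fun_cong[OF z(2), of "Some i"] by simp
        then show ?thesis by (simp add: sval_vec_def y_def vec_eq_iff sval_mult sc)
      qed
      ultimately show "x \<in> sval_vec ` H" by blast
    qed
    show "sval_vec ` H \<subseteq> Q"
    proof (rule image_subsetI)
      fix x assume "x \<in> H"
      then have "homogenize (sval_vec x) \<in> (\<lambda>z k. sval (z k)) ` C"
        by (intro image_eqI[of _ _ "e x"]) (auto simp: H_def e_sval)
      moreover have "sval_vec x \<in> signed_space" by (simp add: signed_space_def sval_vec_def sval_signed)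
      ultimately show "sval_vec x \<in> Q" by (simp add: iff)
    qed
  qed
  ultimately show ?thesis by blast
qed

text \<open>The factors \<open>m k\<close> are signs, so multiplication by them is a linear
  involution, and \<open>sval\<close> is multiplicative.\<close>

lemma sign_change_lift:
  assumes C: "puiseux_cone C" and m: "\<And>k. m k * m k = 1"
  obtains C' where "puiseux_cone C'" "C' = {z. (\<lambda>k. m k * z k) \<in> C}"
    "\<forall>x. x \<in> (\<lambda>z k. sval (z k)) ` C' \<longleftrightarrow> (\<lambda>k. sval (m k) * x k) \<in> (\<lambda>z k. sval (z k)) ` C"
proof
  let ?C = "{z. (\<lambda>k. m k * z k) \<in> C}"
  have mm: "m k * (m k * f) = f" "sval (m k) * (sval (m k) * v) = v" for k f v
    using m[of k] sval_mult[of "m k" "m k"] by (simp_all add: mult.assoc[symmetric] sval_one)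
  have "(\<lambda>k. m k * (z k + w k)) = (\<lambda>k. m k * z k + m k * w k)"
    "(\<lambda>k. m k * (c * z k)) = (\<lambda>k. c * (m k * z k))" for z w c
    by (simp_all add: distrib_left mult.left_commute)
  then show "puiseux_cone ?C" using C by (simp add: puiseux_cone_def)
  show "\<forall>x. x \<in> (\<lambda>z k. sval (z k)) ` ?C \<longleftrightarrow> (\<lambda>k. sval (m k) * x k) \<in> (\<lambda>z k. sval (z k)) ` C"
  proof (intro allI iffI)
    fix x
    assume "x \<in> (\<lambda>z k. sval (z k)) ` ?C"
    then obtain z where z: "(\<lambda>k. m k * z k) \<in> C" "x = (\<lambda>k. sval (z k))" by blast
    then have "(\<lambda>k. sval (m k) * x k) = (\<lambda>k. sval (m k * z k))" by (simp add: sval_mult)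
    with z show "(\<lambda>k. sval (m k) * x k) \<in> (\<lambda>z k. sval (z k)) ` C" by (intro image_eqI)
  next
    fix x assume "(\<lambda>k. sval (m k) * x k) \<in> (\<lambda>z k. sval (z k)) ` C"
    then obtain z where z: "z \<in> C" "(\<lambda>k. sval (m k) * x k) = (\<lambda>k. sval (z k))" by blast
    have "x k = sval (m k * z k)" for k
      using fun_cong[OF z(2), of k] mm(2)[of k "x k"] by (simp add: sval_mult)
    moreover have "(\<lambda>k. m k * z k) \<in> ?C" using z by (simp add: mm)
    ultimately show "x \<in> (\<lambda>z k. sval (z k)) ` ?C" by (intro image_eqI) auto
  qed
qed simp

lemma (in hemispace) lifts:
  shows "\<exists>H :: (puiseux ^ 'n) set. field_convex H \<and> Q = sval_vec ` H" (is ?Q)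
    and "\<exists>H :: (puiseux ^ 'n) set. field_convex H \<and> signed_space - Q = sval_vec ` H" (is ?N)
proof -
  interpret cp: cone_pair None tropical_cone "nonneg_dom - tropical_cone" by (rule cone_pair)
  let ?R = cp.outweighs and ?A = cp.active
  interpret R: dominance ?A ?R by (rule cp.dominance_outweighs)
  interpret R': dominance ?A "\<lambda>i a j b. \<not> ?R j b i a"
    by (rule dominance_dual[OF cp.dominance_outweighs])
  define m :: "'n option \<Rightarrow> puiseux" where "m k = (if cp.sg k = TPos 0 then 1 else - 1)" for k
  have m: "m k * m k = 1" "- m k * - m k = 1" for k by (simp_all add: m_def)
  have sval_m: "sval (m k) = cp.sg k" "sval (- m k) = TNeg 0 * cp.sg k" for k
    using cp.sg_unit[of k] by (auto simp: m_def tsign_unit_def sval_one sval_uminus one_symtrop_def)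
  have Q: "Q \<subseteq> signed_space" using Q_convex by (simp add: TC_convex_def)
  have hom: "homogenize x k \<in> tsigned" "homogenize x None \<notin> tnegative" if "x \<in> signed_space"
    for x :: "symtrop ^ 'n" and k
    using hom_dom[OF that] by (simp_all add: nonneg_dom_def)
  show ?Q
  proof -
    obtain C where C: "puiseux_cone C" "(\<lambda>z k. sval (z k)) ` C = dominated ?A ?R"
      "\<forall>z w. z \<in> C \<longrightarrow> (\<forall>k\<in>?A. w k = z k) \<longrightarrow> w \<in> C"
      by (rule R.dominated_eq_sval_cone)
    obtain C' where C': "puiseux_cone C'" "C' = {z. (\<lambda>k. m k * z k) \<in> C}"
      "\<forall>x. x \<in> (\<lambda>z k. sval (z k)) ` C' \<longleftrightarrow> (\<lambda>k. sval (m k) * x k) \<in> (\<lambda>z k. sval (z k)) ` C"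
      by (rule sign_change_lift[where m = m, OF C(1) m(1)])
    show ?thesis
    proof (rule slice_lift[OF C'(1) Q])
      fix x :: "symtrop ^ 'n" assume x: "x \<in> signed_space"
      show "x \<in> Q \<longleftrightarrow> homogenize x \<in> (\<lambda>z k. sval (z k)) ` C'"
        unfolding C'(3)[rule_format] C(2) sval_m hom_in_cone_iff[OF x, symmetric]
        by (rule cp.P_eq_dominated) (use hom[OF x] in auto)
    qed
  qed
  show ?N
  proof -
    obtain C where C: "puiseux_cone C" "(\<lambda>z k. sval (z k)) ` C = dominated ?A (\<lambda>i a j b. \<not> ?R j b i a)"
      and cong: "\<forall>z w. z \<in> C \<longrightarrow> (\<forall>k\<in>?A. w k = z k) \<longrightarrow> w \<in> C"
      by (rule R'.dominated_eq_sval_cone)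
    obtain C' where C': "puiseux_cone C'" "C' = {z. (\<lambda>k. - m k * z k) \<in> C}"
      "\<forall>x. x \<in> (\<lambda>z k. sval (z k)) ` C' \<longleftrightarrow> (\<lambda>k. sval (- m k) * x k) \<in> (\<lambda>z k. sval (z k)) ` C"
      by (rule sign_change_lift[where m = "\<lambda>k. - m k", OF C(1) m(2)])
    \<comment> \<open>\<open>Z\<close> lifts the vectors vanishing on all active coordinates, which
      belong to the complementary cone without being dominated.\<close>
    define Z where "Z = {z :: 'n option \<Rightarrow> puiseux. \<forall>k\<in>?A. z k = 0}"
    \<comment> \<open>Adding an element of \<open>Z\<close> changes inactive coordinates only, on
      which membership in \<open>C'\<close> does not depend; so the union with \<open>Z\<close> is
      still a cone.\<close>
    have absorb: "w \<in> C'" if "z \<in> C'" "\<And>k. k \<in> ?A \<Longrightarrow> w k = z k" for z w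
      using that cong[rule_format, of "\<lambda>k. - m k * z k" "\<lambda>k. - m k * w k"] by (auto simp: C'(2))
    have "puiseux_cone (C' \<union> Z)"
      unfolding puiseux_cone_def
    proof (intro conjI ballI allI impI)
      fix z w assume "z \<in> C' \<union> Z" "w \<in> C' \<union> Z"
      then consider "z \<in> C'" "w \<in> C'" | "z \<in> C'" "w \<in> Z" | "z \<in> Z" "w \<in> C'" | "z \<in> Z" "w \<in> Z" by blast
      then show "(\<lambda>k. z k + w k) \<in> C' \<union> Z"
      proof cases
        case 1
        with C'(1) show ?thesis by (simp add: puiseux_cone_def)
      next
        case 2
        with absorb[of z "\<lambda>k. z k + w k"] show ?thesis by (simp add: Z_def)
      next
        case 3
        with absorb[of w "\<lambda>k. z k + w k"] show ?thesis by (simp add: Z_def)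
      qed (simp add: Z_def)
    next
      fix z c assume "z \<in> C' \<union> Z" "(0 :: puiseux) < c"
      with C'(1) show "(\<lambda>k. c * z k) \<in> C' \<union> Z" by (auto simp: puiseux_cone_def Z_def)
    qed
    moreover have Z_image: "x \<in> (\<lambda>z k. sval (z k)) ` Z \<longleftrightarrow> (\<forall>k\<in>?A. x k = TZero)"
      if x: "\<And>k. x k \<in> tsigned" for x
    proof
      assume zero: "\<forall>k\<in>?A. x k = TZero"
      have "\<exists>f. sval f = v" if "v \<in> tsigned" for v
      proof (cases v)
        case (TPos r)
        then show ?thesis using sval_pmonom by blast
      next
        case (TNeg r)
        then show ?thesis using sval_uminus[of "pmonom r"] by (auto simp: sval_pmonom)
      qed (use that in \<open>auto simp: sval_eq_simps tsigned_iff\<close>)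
      then have "\<forall>k. \<exists>f. sval f = x k" using x by blast
      then have "\<exists>z. \<forall>k. sval (z k) = x k" by (rule choice)
      then obtain z where z: "\<forall>k. sval (z k) = x k" by (rule exE)
      have "z k = 0" if "k \<in> ?A" for k
        using z[rule_format, of k] zero that sval_eq_simps(3)[of "z k"] by simp
      then have "z \<in> Z" by (simp add: Z_def)
      with z show "x \<in> (\<lambda>z k. sval (z k)) ` Z" by (intro image_eqI[of _ _ z]) auto
    qed (auto simp: Z_def sval_eq_simps)
    ultimately show ?thesis
    proof (intro slice_lift[of "C' \<union> Z"])
      fix x :: "symtrop ^ 'n" assume x: "x \<in> signed_space"
      have "x \<in> signed_space - Q \<longleftrightarrow> homogenize x \<in> nonneg_dom - tropical_cone"
        using x hom_dom[OF x] hom_in_cone_iff[OF x] by blast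
      also have "\<dots> \<longleftrightarrow> (\<forall>k\<in>?A. homogenize x k = TZero) \<or>
          (\<lambda>k. TNeg 0 * (cp.sg k * homogenize x k)) \<in> dominated ?A (\<lambda>i a j b. \<not> ?R j b i a)"
        by (rule cp.N_eq_dominated) (use hom[OF x] in auto)
      also have "\<dots> \<longleftrightarrow> homogenize x \<in> (\<lambda>z k. sval (z k)) ` (C' \<union> Z)"
        unfolding image_Un Un_iff C'(3)[rule_format] C(2) sval_m Z_image[OF hom(1)[OF x]] mult.assoc by blast
      finally show "x \<in> signed_space - Q \<longleftrightarrow> homogenize x \<in> (\<lambda>z k. sval (z k)) ` (C' \<union> Z)" .
    qed auto
  qed
qed

theorem proposition5p5:
  fixes G :: "(symtrop ^ 'n::finite) set"
  assumes "TC_hemispace G"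
  shows "\<exists>H :: (puiseux ^ 'n) set. field_convex H \<and> G = sval_vec ` H"
proof (cases "(\<chi> i. TZero) \<in> G")
  case False
  then interpret hemispace G using assms by unfold_locales
  show ?thesis by (rule lifts(1))
next
  case True
  have "G \<subseteq> signed_space" using assms by (simp add: TC_hemispace_def TC_convex_def)
  then have compl: "signed_space - (signed_space - G) = G" by blast
  \<comment> \<open>The complement avoids the origin, so \<open>G\<close> is lifted as the
    complement of this hemispace.\<close>
  interpret hemispace "signed_space - G"
    using True assms by unfold_locales (auto simp: TC_hemispace_def compl)
  show ?thesis using lifts(2) unfolding compl .
qed

end
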